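(* Let $X$ be a real Banach space, let $(\Omega,\Sigma,\mu)$ be a complete probability space, let $1\leq p<\infty$, and let $n$ be a positive integer. Let $Y$ be a vector subspace of $X$ which is weakly $\mathcal{K}$-analytic and $p$-simultaneously proximinal in $X$ (for $n$-tuples). Then $L_p(\mu,Y)$ is $p$-simultaneously proximinal in $L_p(\mu,X)$ (for $n$-tuples); that is, for every $f_1,\ldots,f_n\in L_p(\mu,X)$ there exists $g\in L_p(\mu,Y)$ with $$\sum_{i=1}^n\|f_i-g\|_p^p\leq \sum_{i=1}^n\|f_i-h\|_p^p\quad\text{for all } h\in L_p(\mu,Y).$$
   Context: $L_p(\mu,X)$ denotes the Banach space of (classes of) Bochner $p$-integrable functions $\Omega\to X$ with norm $\|f\|_p=(\int_\Omega\|f(s)\|^p\,d\mu(s))^{1/p}$; $L_p(\mu,Y)$ is the subspace of those taking values in $Y$. For a subset $Y$ of a normed space $X$, a finite set $A=\{a_1,\ldots,a_n\}\subset X$ and $m\in[1,\infty)$, a point $y_0\in Y$ is a relative $m$-center of $A$ in $Y$ if $\sum_{i=1}^n\|a_i-y_0\|^m\leq\sum_{i=1}^n\|a_i-y\|^m$ for all $y\in Y$. $Y$ is called $m$-simultaneously proximinal in $X$ if every $n$-tuple $a_1,\ldots,a_n\in X$ admits a relative $m$-center in $Y$. A subset $A$ of a Hausdorff space $T$ is $\mathcal{K}$-analytic if there is an upper semi-continuous map $\Psi$ from $\mathbb{N}^{\mathbb{N}}$ (product topology) to the nonempty compact subsets of $T$ with $A=\bigcup_{\sigma\in\mathbb{N}^{\mathbb{N}}}\Psi(\sigma)$;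 here upper semi-continuous means that for every $\sigma$ and every open $V\supset\Psi(\sigma)$ there is a neighborhood $U$ of $\sigma$ with $\bigcup_{u\in U}\Psi(u)\subset V$. $Y$ is weakly $\mathcal{K}$-analytic if it is $\mathcal{K}$-analytic in the weak topology of $X$. *)

theory Defs
  imports "HOL-Probability.Probability"
begin

definition weak_topology :: "'a::real_normed_vector topology" where
  "weak_topology = topology_generated_by
     {f -` U | f U. bounded_linear (f :: 'a \<Rightarrow> real) \<and> open U}"

text \<open>K-analytic subset of a topological space: union of an upper semi-continuous
  compact-valued map on the Baire space nat => nat (product topology).\<close>
definition K_analytic_in :: "'a topology \<Rightarrow> 'a set \<Rightarrow> bool" where
  "K_analytic_in T A \<longleftrightarrow>
     (\<exists>\<Psi> :: (nat \<Rightarrow> nat) \<Rightarrow> 'a set.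
        (\<forall>\<sigma>. \<Psi> \<sigma> \<noteq> {} \<and> compactin T (\<Psi> \<sigma>)) \<and>
        (\<forall>\<sigma> V. openin T V \<and> \<Psi> \<sigma> \<subseteq> V \<longrightarrow>
            (\<exists>U. open U \<and> \<sigma> \<in> U \<and> (\<Union>u\<in>U. \<Psi> u) \<subseteq> V)) \<and>
        A = (\<Union>\<sigma>. \<Psi> \<sigma>))"

definition weakly_K_analytic :: "'a::real_normed_vector set \<Rightarrow> bool" where
  "weakly_K_analytic Y \<longleftrightarrow> K_analytic_in weak_topology Y"

definition relative_center ::
    "real \<Rightarrow> nat \<Rightarrow> (nat \<Rightarrow> 'a::real_normed_vector) \<Rightarrow> 'a set \<Rightarrow> 'a \<Rightarrow> bool" where
  "relative_center m n a Y y0 \<longleftrightarrow> y0 \<in> Y \<and>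
     (\<forall>y\<in>Y. (\<Sum>i<n. norm (a i - y0) powr m) \<le> (\<Sum>i<n. norm (a i - y) powr m))"

definition simult_proximinal :: "real \<Rightarrow> nat \<Rightarrow> 'a::real_normed_vector set \<Rightarrow> bool" where
  "simult_proximinal m n Y \<longleftrightarrow> (\<forall>a. \<exists>y0. relative_center m n a Y y0)"

definition strongly_measurable :: "'s measure \<Rightarrow> ('s \<Rightarrow> 'a::real_normed_vector) \<Rightarrow> bool" where
  "strongly_measurable M f \<longleftrightarrow>
     (\<exists>s :: nat \<Rightarrow> 's \<Rightarrow> 'a. (\<forall>i. simple_function M (s i)) \<and>
        (AE x in M. (\<lambda>i. s i x) \<longlonglongrightarrow> f x))"

text \<open>Representatives of elements of L_p(M, Y): Bochner measurable, a.e. Y-valued,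
  with p-integrable norm.\<close>
definition Lp_space :: "'s measure \<Rightarrow> real \<Rightarrow> 'a::real_normed_vector set \<Rightarrow> ('s \<Rightarrow> 'a) set" where
  "Lp_space M p Y = {f. strongly_measurable M f \<and> (AE x in M. f x \<in> Y) \<and>
                        integrable M (\<lambda>x. norm (f x) powr p)}"

definition Lp_norm :: "'s measure \<Rightarrow> real \<Rightarrow> ('s \<Rightarrow> 'a::real_normed_vector) \<Rightarrow> real" where
  "Lp_norm M p f = (\<integral>x. norm (f x) powr p \<partial>M) powr (1 / p)"

end

(* Pointwise, let P(a) be the set of relative p-centers of a tuple a in Y; one needs a
   strongly measurable selection of P along the tuple (f_1, ..., f_n), after which the
   optimality can be integrated.  The graph of P is closed for the norm topology in a and
   the weak topology in y.  Write Y as the union of the sets Psi(sigma).  Continuity of the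
   outer measure along increasing unions yields, as in the proof of capacitability, a tau
   such that up to measure epsilon the tuple has a center in the weakly compact set
   W = union of Psi(sigma) over sigma <= tau.  On that part the multifunction of the centers
   in W is upper semi-continuous with weakly compact values, so by taking one center for each
   point of a dense sequence and a closed linear span (weakly closed by Hahn-Banach) one finds
   a separable subspace that still contains a center for every point.  A measurable
   selection is obtained by successively minimising the distances to the points of a dense
   sequence of this subspace; weak compactness gives minimisers and density makes the
   selected point unique. *)

theory Submission
  imports Defs
begin

subsection \<open>Hahn-Banach and weakly closed sets\<close>

text \<open>Homogeneity is asked only as an inequality, which is easier to check for infima; using
  it again with \<open>1 / c\<close> gives equality for \<open>c > 0\<close>.\<close>

definition sublinear :: "('a::real_vector \<Rightarrow> real) \<Rightarrow> bool" where
  "sublinear q \<longleftrightarrow> (\<forall>x y. q (x + y) \<le> q x + q y) \<and> (\<forall>c x. 0 \<le> c \<longrightarrow> q (c *\<^sub>R x) \<le> c * q x)"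

lemma sublinearI:
  assumes "\<And>x y. q (x + y) \<le> q x + q y" "\<And>c x. 0 \<le> c \<Longrightarrow> q (c *\<^sub>R x) \<le> c * q x"
  shows "sublinear q"
  using assms by (auto simp: sublinear_def)

lemma sublinear_add: "sublinear q \<Longrightarrow> q (x + y) \<le> q x + q y"
  and sublinear_scaleR_le: "sublinear q \<Longrightarrow> 0 \<le> c \<Longrightarrow> q (c *\<^sub>R x) \<le> c * q x"
  by (auto simp: sublinear_def)

lemma sublinear_zero:
  assumes "sublinear q" shows "q 0 = 0"
  using sublinear_add[OF assms, of 0 0] sublinear_scaleR_le[OF assms, of 0 0] by simp

lemma sublinear_minus_le:
  assumes "sublinear q" shows "- q (- x) \<le> q x"
  using sublinear_add[OF assms, of x "- x"] sublinear_zero[OF assms] by simp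

text \<open>A linear functional below \<open>directional_inf q y\<close> is below \<open>q\<close> and agrees with it at \<open>y\<close>.\<close>
definition directional_inf :: "('a::real_vector \<Rightarrow> real) \<Rightarrow> 'a \<Rightarrow> 'a \<Rightarrow> real" where
  "directional_inf q y x = (INF t\<in>{0..}. q (x + t *\<^sub>R y) - t * q y)"

text \<open>The infimum is finite because of the lower bound \<open>- q (- x)\<close>; the
  parameters \<open>t = 0\<close> and \<open>t = 1\<close> give the last two claims. Sublinearity
  holds because the half-line of parameters is closed under sums and positive multiples.\<close>

lemma
  fixes q :: "'a::real_vector \<Rightarrow> real"
  assumes q: "sublinear q"
  shows sublinear_directional_inf: "sublinear (directional_inf q y)"
    and directional_inf_le: "directional_inf q y x \<le> q x"
    and directional_inf_le_diff: "directional_inf q y x \<le> q (x + y) - q y"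
proof -
  define r where "r = directional_inf q"
  note r_def = r_def directional_inf_def
  have low: "- q (- x) \<le> q (x + t *\<^sub>R y) - t * q y" if "0 \<le> t" for x t
    using sublinear_add[OF q, of "x + t *\<^sub>R y" "- x"] sublinear_scaleR_le[OF q that, of y]
      sublinear_scaleR_le[OF q, of "1/t" "t *\<^sub>R y"] that sublinear_zero[OF q]
    by (cases "t = 0") (auto simp: field_simps)
  have bdd: "bdd_below ((\<lambda>t. q (x + t *\<^sub>R y) - t * q y) ` {0..})" for x
    by (rule bdd_belowI2[of _ "- q (- x)"]) (use low in auto)
  have le: "r y x \<le> q (x + t *\<^sub>R y) - t * q y" if "0 \<le> t" for x t
    unfolding r_def using that by (intro cINF_lower[OF bdd]) auto
  have ge: "z \<le> r y x" if "\<And>t. 0 \<le> t \<Longrightarrow> z \<le> q (x + t *\<^sub>R y) - t * q y" for z x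
    unfolding r_def using that by (intro cINF_greatest) auto
  show "directional_inf q y x \<le> q x" "directional_inf q y x \<le> q (x + y) - q y"
    using le[of 0 x] le[of 1 x] by (auto simp: r_def(1))
  have "sublinear (r y)"
  proof (rule sublinearI)
    fix x x'
    \<comment> \<open>Parameters \<open>s\<close> and \<open>t\<close> are matched by
      \<open>s + t\<close> on the left; taking the infimum over \<open>t\<close> and then over
      \<open>s\<close> gives subadditivity.\<close>
    have "r y (x + x') \<le> (q (x + s *\<^sub>R y) - s * q y) + (q (x' + t *\<^sub>R y) - t * q y)"
      if "0 \<le> s" "0 \<le> t" for s t
      using le[of "s + t" "x + x'"] that sublinear_add[OF q, of "x + s *\<^sub>R y" "x' + t *\<^sub>R y"]
      by (simp add: algebra_simps)
    then have "r y (x + x') - (q (x + s *\<^sub>R y) - s * q y) \<le> r y x'" if "0 \<le> s" for s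
      using that by (intro ge) (smt (verit))
    then have "r y (x + x') - r y x' \<le> r y x"
      by (intro ge) (smt (verit))
    then show "r y (x + x') \<le> r y x + r y x'" by simp
  next
    fix c :: real and x assume c: "0 \<le> c"
    show "r y (c *\<^sub>R x) \<le> c * r y x"
    proof (cases "c = 0")
      case True
      then show ?thesis using le[of 0 0] sublinear_zero[OF q] by simp
    next
      case False
      have "r y (c *\<^sub>R x) / c \<le> q (x + t *\<^sub>R y) - t * q y" if "0 \<le> t" for t
      proof -
        have "r y (c *\<^sub>R x) \<le> q (c *\<^sub>R (x + t *\<^sub>R y)) - c * t * q y"
          using le[of "c * t" "c *\<^sub>R x"] that c by (simp add: algebra_simps)
        also have "\<dots> \<le> c * (q (x + t *\<^sub>R y) - t * q y)"
          using sublinear_scaleR_le[OF q c, of "x + t *\<^sub>R y"] by (simp add: algebra_simps)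
        finally show ?thesis using c False by (simp add: field_simps)
      qed
      then have "r y (c *\<^sub>R x) / c \<le> r y x" by (rule ge)
      then show ?thesis using c False by (simp add: field_simps)
    qed
  qed
  then show "sublinear (directional_inf q y)" by (simp add: r_def(1))
qed

text \<open>Minimality forces \<open>directional_inf q y = q\<close>, so
  \<open>q x + q y \<le> q (x + y)\<close>. Subadditivity gives equality, and oddness extends
  homogeneity to negative scalars.\<close>

lemma minimal_sublinear_imp_linear:
  fixes q :: "'a::real_vector \<Rightarrow> real"
  assumes q: "sublinear q" and min: "\<And>r. sublinear r \<Longrightarrow> (\<forall>x. r x \<le> q x) \<Longrightarrow> r = q"
  shows "linear q"
proof -
  have add: "q (x + y) = q x + q y" for x y
  proof -
    have "directional_inf q y = q"
      using sublinear_directional_inf[OF q] directional_inf_le[OF q] by (intro min) auto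
    then have "q x \<le> q (x + y) - q y"
      using directional_inf_le_diff[OF q, of y x] by simp
    then show ?thesis using sublinear_add[OF q, of x y] by simp
  qed
  have minus: "q (- x) = - q x" for x
    using add[of x "- x"] sublinear_zero[OF q] by simp
  have scal: "q (c *\<^sub>R x) = c * q x" if "0 \<le> c" for c x
    using sublinear_scaleR_le[OF q that, of x] sublinear_scaleR_le[OF q that, of "- x"]
    by (simp add: minus)
  have "q (c *\<^sub>R x) = c * q x" for c x
    using scal[of c x] scal[of "- c" x] minus[of "c *\<^sub>R x"] by (cases "0 \<le> c") auto
  then show ?thesis using add by (intro linearI) auto
qed

text \<open>Zorn's lemma gives a minimal sublinear functional below \<open>p\<close>, and such a
  functional is linear. Chains are bounded by their pointwise infimum, which is finite because every
  member at \<open>x\<close> is at least \<open>- p (- x)\<close>.\<close>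

lemma linear_below_sublinear:
  fixes p :: "'a::real_vector \<Rightarrow> real"
  assumes p: "sublinear p"
  obtains f where "linear f" "\<And>x. f x \<le> p x"
proof -
  define A where "A = {q. sublinear q \<and> (\<forall>x. q x \<le> p x)}"
  \<comment> \<open>The order is reversed, so the maximal element from Zorn's lemma is a minimal
    functional.\<close>
  define P where "P = (\<lambda>q r :: 'a \<Rightarrow> real. \<forall>x. r x \<le> q x)"
  have "\<exists>m\<in>A. \<forall>a\<in>A. P m a \<longrightarrow> a = m"
  proof (rule predicate_Zorn)
    show "partial_order_on A (relation_of P A)"
      by (rule partial_order_on_relation_ofI) (auto simp: P_def fun_eq_iff intro: order_trans order_antisym)
  next
    fix C assume "C \<in> Chains (relation_of P A)"
    then have CA: "C \<subseteq> A" and ch: "\<And>q r. q \<in> C \<Longrightarrow> r \<in> C \<Longrightarrow> P q r \<or> P r q"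
      by (auto simp: Chains_def relation_of_def)
    show "\<exists>u\<in>A. \<forall>a\<in>C. P a u"
    proof (cases "C = {}")
      case True
      then show ?thesis using p by (auto simp: A_def)
    next
      case False
      have sub: "sublinear q" "q x \<le> p x" if "q \<in> C" for q x
        using that CA by (auto simp: A_def)
      have low: "- p (- x) \<le> q x" if "q \<in> C" for q x
        using sublinear_minus_le[OF sub(1)[OF that], of x] sub(2)[OF that, of "- x"] by simp
      define u where "u x = (INF q\<in>C. q x)" for x
      have bdd: "bdd_below ((\<lambda>q. q x) ` C)" for x
        by (rule bdd_belowI2[of _ "- p (- x)"]) (use low in auto)
      have le: "u x \<le> q x" if "q \<in> C" for x q
        unfolding u_def by (intro cINF_lower[OF bdd] that)
      have ge: "z \<le> u x" if "\<And>q. q \<in> C \<Longrightarrow> z \<le> q x" for z x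
        unfolding u_def using that False by (intro cINF_greatest) auto
      have "sublinear u"
      proof (rule sublinearI)
        fix x y
        \<comment> \<open>The smaller of the two comparable members is subadditive and lies below
          both \<open>q\<close> and \<open>r\<close>.\<close>
        have *: "u (x + y) \<le> q x + r y" if "q \<in> C" "r \<in> C" for q r
          using ch[OF that] le[OF that(1), of "x + y"] le[OF that(2), of "x + y"]
            sublinear_add[OF sub(1)[OF that(1)], of x y] sublinear_add[OF sub(1)[OF that(2)], of x y]
          unfolding P_def by (smt (verit))
        have "u (x + y) - q x \<le> u y" if "q \<in> C" for q
          using *[OF that] by (intro ge) (simp add: algebra_simps)
        then have "u (x + y) - u y \<le> u x"
          by (intro ge) (simp add: algebra_simps)
        then show "u (x + y) \<le> u x + u y" by simp
      next
        fix c :: real and x assume c: "0 \<le> c"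
        have le': "u (c *\<^sub>R x) \<le> c * q x" if "q \<in> C" for q
          using le[OF that] sublinear_scaleR_le[OF sub(1)[OF that] c, of x] by (rule order_trans)
        show "u (c *\<^sub>R x) \<le> c * u x"
        proof (cases "c = 0")
          case True
          then show ?thesis using le' False by auto
        next
          case False
          then have "u (c *\<^sub>R x) / c \<le> u x"
            using le' c by (intro ge) (simp add: field_simps)
          then show ?thesis using c False by (simp add: field_simps)
        qed
      qed
      then show ?thesis
        using le sub(2) False unfolding A_def P_def
        by (intro bexI[of _ u]) (auto, meson ex_in_conv order_trans)
    qed
  qed
  then obtain f where f: "f \<in> A" "\<And>a. a \<in> A \<Longrightarrow> P f a \<Longrightarrow> a = f" by blast
  have "linear f"
    using f by (intro minimal_sublinear_imp_linear) (auto simp: A_def P_def intro: order_trans)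
  then show ?thesis using f(1) that by (auto simp: A_def)
qed

text \<open>Staying below \<open>directional_inf p x0\<close> bounds the functional at
  \<open>- x0\<close> by \<open>- p x0\<close>, which turns the inequality at \<open>x0\<close> into
  an equality.\<close>

theorem Hahn_Banach_sublinear:
  fixes p :: "'a::real_vector \<Rightarrow> real"
  assumes p: "sublinear p"
  obtains f where "linear f" "\<And>x. f x \<le> p x" "f x0 = p x0"
proof -
  obtain f where f: "linear f" "\<And>x. f x \<le> directional_inf p x0 x"
    using linear_below_sublinear[OF sublinear_directional_inf[OF p]] by blast
  have "f (- x0) \<le> - p x0"
    using f(2)[of "- x0"] directional_inf_le_diff[OF p, of x0 "- x0"] sublinear_zero[OF p] by simp
  then have "p x0 \<le> f x0"
    using linear_neg[OF f(1), of x0] by simp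
  moreover have "f x \<le> p x" for x
    using f(2) directional_inf_le[OF p] by (rule order_trans)
  ultimately show ?thesis using that f(1) by (metis order_antisym)
qed

text \<open>Domination by the norm makes the functional continuous. It is applied to the norm, for
  norming functionals, and to the distance from a subspace, for separation.\<close>

lemma Hahn_Banach_seminorm:
  fixes q :: "'a::real_normed_vector \<Rightarrow> real"
  assumes q: "sublinear q" and le: "\<And>x. q x \<le> norm x"
  obtains f where "bounded_linear f" "\<And>x. f x \<le> q x" "f x0 = q x0"
proof -
  obtain f where f: "linear f" "\<And>x. f x \<le> q x" "f x0 = q x0"
    using Hahn_Banach_sublinear[OF q] by blast
  have "\<bar>f x\<bar> \<le> norm x" for x
    using f(2)[of x] f(2)[of "- x"] le[of x] le[of "- x"] linear_neg[OF f(1), of x] by simp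
  then have "bounded_linear f"
    using f(1) by (intro bounded_linear_intro[where K=1]) (auto simp: linear_add linear_cmul)
  then show ?thesis using f that by blast
qed

section \<open>Weakly closed balls and subspaces\<close>

lemma topspace_weak_topology [simp]: "topspace weak_topology = UNIV"
proof -
  have "(\<lambda>_::'a. 0::real) -` UNIV \<in> {f -` U | f U. bounded_linear (f :: 'a \<Rightarrow> real) \<and> open U}"
    using bounded_linear_zero open_UNIV by blast
  then show ?thesis
    unfolding weak_topology_def topology_generated_by_topspace by auto
qed

lemma openin_weak_topology_less:
  fixes f :: "'a::real_normed_vector \<Rightarrow> real"
  assumes "bounded_linear f"
  shows "openin weak_topology {x. c < f x}"
proof -
  have "{x. c < f x} = f -` {c<..}" "open {c<..}" by auto
  then show ?thesis
    unfolding weak_topology_def using assms by (intro topology_generated_by_Basis) blast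
qed

text \<open>A functional \<open>f\<close> norming \<open>x - y\<close> gives the weakly open
  half-space of all \<open>v\<close> with \<open>r < f (x - v)\<close>; it contains
  \<open>y\<close>, and on it the distance to \<open>x\<close> exceeds \<open>r\<close>.\<close>

lemma openin_weak_norm_greater:
  fixes x :: "'a::real_normed_vector"
  shows "openin weak_topology {y. r < norm (x - y)}"
proof (subst openin_subopen, safe)
  fix y assume y: "r < norm (x - y)"
  have "sublinear (norm :: 'a \<Rightarrow> real)"
    by (intro sublinearI norm_triangle_ineq) simp
  then obtain f where f: "bounded_linear f" "\<And>v. f v \<le> norm v" "f (x - y) = norm (x - y)"
    using Hahn_Banach_seminorm[of norm "x - y"] by (metis order_refl)
  interpret bounded_linear f by fact
  have "bounded_linear (\<lambda>v. - f v)" using f(1) by (rule bounded_linear_minus)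
  then have "openin weak_topology {v. r - f x < - f v}"
    by (rule openin_weak_topology_less)
  moreover have "y \<in> {v. r - f x < - f v}"
    using y f(3) by (simp add: diff)
  moreover have "{v. r - f x < - f v} \<subseteq> {y. r < norm (x - y)}"
    using f(2) by (auto simp: diff) (smt (verit) diff)
  ultimately show "\<exists>T. openin weak_topology T \<and> y \<in> T \<and> T \<subseteq> {y. r < norm (x - y)}"
    by blast
qed

lemma closedin_weak_cball:
  fixes x :: "'a::real_normed_vector"
  shows "closedin weak_topology (cball x r)"
proof -
  have "UNIV - cball x r = {y. r < norm (x - y)}" by (auto simp: dist_norm)
  then show ?thesis
    by (simp add: closedin_def openin_weak_norm_greater)
qed

text \<open>The distance is the dominating functional for separating a point from \<open>S\<close>,
  on which it vanishes. Sublinearity holds because competitors can be added and scaled inside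
  \<open>S\<close>.\<close>

lemma sublinear_infdist:
  fixes S :: "'a::real_normed_vector set"
  assumes S: "subspace S"
  shows "sublinear (\<lambda>x. infdist x S)"
proof -
  have ne: "S \<noteq> {}" using S subspace_0 by blast
  have ge: "z \<le> infdist x S" if "\<And>s. s \<in> S \<Longrightarrow> z \<le> dist x s" for z x
    using ne that by (auto simp: infdist_def intro: cINF_greatest)
  show ?thesis
  proof (rule sublinearI)
    fix x y
    have *: "infdist (x + y) S \<le> dist x s + dist y t" if "s \<in> S" "t \<in> S" for s t
      using infdist_le2[OF subspace_add[OF S that], of "x + y"] dist_triangle_add[of x y s t] by simp
    have "infdist (x + y) S - dist x s \<le> infdist y S" if "s \<in> S" for s
      using *[OF that] by (intro ge) (simp add: algebra_simps)
    then have "infdist (x + y) S - infdist y S \<le> infdist x S"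
      by (intro ge) (simp add: algebra_simps)
    then show "infdist (x + y) S \<le> infdist x S + infdist y S" by simp
  next
    fix c :: real and x assume c: "0 \<le> c"
    show "infdist (c *\<^sub>R x) S \<le> c * infdist x S"
    proof (cases "c = 0")
      case True
      then show ?thesis using subspace_0[OF S] by simp
    next
      case False
      have "infdist (c *\<^sub>R x) S / c \<le> dist x s" if "s \<in> S" for s
      proof -
        have "dist (c *\<^sub>R x) (c *\<^sub>R s) = c * dist x s"
          unfolding dist_norm scaleR_diff_right[symmetric] using c by simp
        then show ?thesis
          using infdist_le[OF subspace_scale[OF S that], of "c *\<^sub>R x" c] c False
          by (simp add: pos_divide_le_eq mult.commute)
      qed
      then have "infdist (c *\<^sub>R x) S / c \<le> infdist x S" by (rule ge)
      then show ?thesis using c False by (simp add: field_simps)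
    qed
  qed
qed

text \<open>Hahn-Banach below \<open>infdist\<close> gives a functional that is positive at a point
  outside \<open>S\<close> and at most \<open>0\<close> on \<open>S\<close>;
  \<open>{x. 0 < f x}\<close> is the separating weak neighbourhood.\<close>

lemma closedin_weak_closed_subspace:
  fixes S :: "'a::real_normed_vector set"
  assumes S: "subspace S" "closed S"
  shows "closedin weak_topology S"
proof -
  have "openin weak_topology (UNIV - S)"
  proof (subst openin_subopen, safe)
    fix y assume y: "y \<notin> S"
    have le: "infdist x S \<le> norm x" for x
      using infdist_le[OF subspace_0[OF S(1)], of x] by simp
    obtain f where f: "bounded_linear f" "\<And>v. f v \<le> infdist v S" "f y = infdist y S"
      using Hahn_Banach_seminorm[OF sublinear_infdist[OF S(1)] le, of y] by blast
    have "0 < infdist y S"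
      using y S subspace_0[OF S(1)] by (metis closure_closed empty_iff in_closure_iff_infdist_zero infdist_nonneg less_eq_real_def)
    moreover have "f v \<le> 0" if "v \<in> S" for v
      using f(2)[of v] that by simp
    ultimately show "\<exists>T. openin weak_topology T \<and> y \<in> T \<and> T \<subseteq> UNIV - S"
      using openin_weak_topology_less[OF f(1), of 0] f(3)
      by (intro exI[of _ "{x. 0 < f x}"]) force
  qed
  then show ?thesis by (simp add: closedin_def)
qed

subsection \<open>Upper semi-continuous multifunctions\<close>

lemma compact_le_fun:
  fixes \<tau> :: "nat \<Rightarrow> nat"
  shows "compact {\<sigma>. \<forall>i. \<sigma> i \<le> \<tau> i}"
proof -
  have "compactin (product_topology (\<lambda>i::nat. euclidean) UNIV) (PiE UNIV (\<lambda>i. {..\<tau> i}))"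
    by (subst compactin_PiE) (simp add: finite_imp_compact)
  then have "compact (PiE UNIV (\<lambda>i. {..\<tau> i}))"
    by (simp add: euclidean_product_topology flip: compactin_euclidean_iff)
  moreover have "PiE UNIV (\<lambda>i. {..\<tau> i}) = {\<sigma>. \<forall>i. \<sigma> i \<le> \<tau> i}"
    by (auto simp: PiE_def Pi_def)
  ultimately show ?thesis by simp
qed

lemma tendsto_fun_iff:
  fixes f :: "'c \<Rightarrow> 'i \<Rightarrow> 'b::topological_space"
  shows "(f \<longlongrightarrow> l) F \<longleftrightarrow> (\<forall>i. ((\<lambda>x. f x i) \<longlongrightarrow> l i) F)"
proof -
  have "(f \<longlongrightarrow> l) F \<longleftrightarrow> limitin (product_topology (\<lambda>i. euclidean) UNIV) f l F"
    by (simp add: euclidean_product_topology limitin_canonical_iff)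
  then show ?thesis by (simp add: limitin_componentwise)
qed

text \<open>Truncating \<open>s k\<close> at \<open>\<tau>\<close> puts the sequence into a compact
  box and can change coordinate \<open>i\<close> only for \<open>k \<le> i\<close>, so limits of
  subsequences are unaffected.\<close>

lemma subseq_convergent_if_coordinates_bounded:
  fixes s :: "nat \<Rightarrow> nat \<Rightarrow> nat"
  assumes s: "\<And>k i. i < k \<Longrightarrow> s k i \<le> \<tau> i"
  shows "\<exists>r \<sigma>. strict_mono r \<and> (s \<circ> r) \<longlonglongrightarrow> \<sigma> \<and> (\<forall>i. \<sigma> i \<le> \<tau> i)"
proof -
  define t where "t k = (\<lambda>i. min (s k i) (\<tau> i))" for k
  have "seq_compact {\<sigma>. \<forall>i. \<sigma> i \<le> \<tau> i}"
    by (rule compact_imp_seq_compact[OF compact_le_fun])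
  moreover have "\<forall>k. t k \<in> {\<sigma>. \<forall>i. \<sigma> i \<le> \<tau> i}"
    by (auto simp: t_def)
  ultimately obtain \<sigma> r where r: "\<sigma> \<in> {\<sigma>. \<forall>i. \<sigma> i \<le> \<tau> i}" "strict_mono r" "(t \<circ> r) \<longlonglongrightarrow> \<sigma>"
    by (rule seq_compactE)
  have "(s \<circ> r) \<longlonglongrightarrow> \<sigma>"
    unfolding tendsto_fun_iff
  proof
    fix i
    have "\<forall>\<^sub>F k in sequentially. (t \<circ> r) k i = (s \<circ> r) k i"
      using eventually_gt_at_top[of i]
    proof eventually_elim
      case (elim k)
      then have "i < r k" using seq_suble[OF r(2), of k] by simp
      then show ?case using s[of i "r k"] by (simp add: t_def)
    qed
    moreover have "(\<lambda>k. (t \<circ> r) k i) \<longlonglongrightarrow> \<sigma> i"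
      using r(3) unfolding tendsto_fun_iff by blast
    ultimately show "(\<lambda>k. (s \<circ> r) k i) \<longlonglongrightarrow> \<sigma> i"
      by (rule Lim_transform_eventually[rotated])
  qed
  then show ?thesis using r by blast
qed

text \<open>Otherwise finitely many open sets, each eventually avoided by \<open>y\<close>, would
  cover \<open>\<Psi> \<sigma>\<close>, while upper semi-continuity forces \<open>y k\<close> into
  their union. Cluster points replace subsequential limits because \<open>T\<close> may have no
  countable neighbourhood bases.\<close>

lemma usco_sequence_cluster_point:
  fixes \<Psi> :: "'b::topological_space \<Rightarrow> 'a set"
  assumes comp: "compactin T (\<Psi> \<sigma>)"
    and usc: "\<And>V. openin T V \<Longrightarrow> \<Psi> \<sigma> \<subseteq> V \<Longrightarrow> \<exists>U. open U \<and> \<sigma> \<in> U \<and> (\<Union>u\<in>U. \<Psi> u) \<subseteq> V"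
    and s: "s \<longlonglongrightarrow> \<sigma>" and y: "\<And>k. y k \<in> \<Psi> (s k)"
  obtains z where "z \<in> \<Psi> \<sigma>" "\<And>V. openin T V \<Longrightarrow> z \<in> V \<Longrightarrow> \<exists>\<^sub>F k in sequentially. y k \<in> V"
proof (rule ccontr)
  assume "\<not> thesis"
  then have "\<forall>z\<in>\<Psi> \<sigma>. \<exists>V. openin T V \<and> z \<in> V \<and> (\<forall>\<^sub>F k in sequentially. y k \<notin> V)"
    using that by (metis not_frequently)
  then obtain V where V: "\<And>z. z \<in> \<Psi> \<sigma> \<Longrightarrow> openin T (V z) \<and> z \<in> V z \<and> (\<forall>\<^sub>F k in sequentially. y k \<notin> V z)"
    by metis
  obtain \<F> where F: "finite \<F>" "\<F> \<subseteq> V ` \<Psi> \<sigma>" "\<Psi> \<sigma> \<subseteq> \<Union>\<F>"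
  proof -
    have "\<exists>\<F>. finite \<F> \<and> \<F> \<subseteq> V ` \<Psi> \<sigma> \<and> \<Psi> \<sigma> \<subseteq> \<Union>\<F>"
      by (rule compactinD[OF comp]) (use V in auto)
    then show ?thesis using that by blast
  qed
  have op: "openin T (\<Union>\<F>)" using F(2) V by (intro openin_Union) auto
  obtain U where U: "open U" "\<sigma> \<in> U" "(\<Union>u\<in>U. \<Psi> u) \<subseteq> \<Union>\<F>"
    using usc[OF op F(3)] by blast
  have "\<forall>\<^sub>F k in sequentially. \<forall>W\<in>\<F>. y k \<notin> W"
    using F(1,2) V by (auto intro!: eventually_ball_finite)
  moreover have "\<forall>\<^sub>F k in sequentially. s k \<in> U"
    using s U(1,2) by (rule topological_tendstoD)
  ultimately have "\<forall>\<^sub>F k in sequentially. False"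
  proof eventually_elim
    case (elim k)
    then show ?case using y[of k] U(3) by blast
  qed
  then show False by simp
qed

text \<open>In the application \<open>P b\<close> is the set of relative centers of the tuple
  \<open>b\<close>. Closedness of the graph combines convergence in \<open>b\<close> with weak
  cluster points in the values, and concerns only points \<open>z\<close> of some
  \<open>\<Psi> \<sigma>\<close>, that is, of \<open>Y\<close>.\<close>

locale weak_usco_multifunction =
  fixes \<Psi> :: "(nat \<Rightarrow> nat) \<Rightarrow> 'a::real_normed_vector set" and P :: "'b::metric_space \<Rightarrow> 'a set"
  assumes compactin_values: "\<And>\<sigma>. compactin weak_topology (\<Psi> \<sigma>)"
    and usc: "\<And>\<sigma> V. openin weak_topology V \<Longrightarrow> \<Psi> \<sigma> \<subseteq> V \<Longrightarrow> \<exists>U. open U \<and> \<sigma> \<in> U \<and> (\<Union>u\<in>U. \<Psi> u) \<subseteq> V"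
    and meets: "\<And>b. \<exists>\<sigma>. \<Psi> \<sigma> \<inter> P b \<noteq> {}"
    and closed_graph: "\<And>\<beta> b y z \<sigma>. \<beta> \<longlonglongrightarrow> b \<Longrightarrow> (\<And>k. y k \<in> P (\<beta> k)) \<Longrightarrow> z \<in> \<Psi> \<sigma> \<Longrightarrow>
      (\<And>V. openin weak_topology V \<Longrightarrow> z \<in> V \<Longrightarrow> \<exists>\<^sub>F k in sequentially. y k \<in> V) \<Longrightarrow> z \<in> P b"
begin

text \<open>Restricting the index to a compact box makes the union of the
  \<open>\<Psi> \<sigma>\<close> weakly compact, which the union over all indices in general is
  not.\<close>

definition slice :: "(nat \<Rightarrow> nat) \<Rightarrow> 'b \<Rightarrow> 'a set" where
  "slice \<tau> b = (\<Union>\<sigma>\<in>{\<sigma>. \<forall>i. \<sigma> i \<le> \<tau> i}. \<Psi> \<sigma>) \<inter> P b"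

text \<open>Only the first \<open>k\<close> coordinates of \<open>s k\<close> are bounded, which is what the approximations of \<open>\<tau>\<close> by
  finite prefixes provide.\<close>
lemma slice_cluster_point_approx:
  assumes \<beta>: "\<beta> \<longlonglongrightarrow> b" and y: "\<And>k. y k \<in> \<Psi> (s k)" "\<And>k. y k \<in> P (\<beta> k)"
    and s: "\<And>k i. i < k \<Longrightarrow> s k i \<le> \<tau> i"
  shows "\<exists>z\<in>slice \<tau> b. \<forall>F. closedin weak_topology F \<longrightarrow> (\<forall>\<^sub>F k in sequentially. y k \<in> F) \<longrightarrow> z \<in> F"
proof -
  obtain r \<sigma> where r: "strict_mono r" "(s \<circ> r) \<longlonglongrightarrow> \<sigma>" "\<And>i. \<sigma> i \<le> \<tau> i"
    using subseq_convergent_if_coordinates_bounded[of s \<tau>, OF s] by blast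
  obtain z where z: "z \<in> \<Psi> \<sigma>"
    "\<And>V. openin weak_topology V \<Longrightarrow> z \<in> V \<Longrightarrow> \<exists>\<^sub>F k in sequentially. (y \<circ> r) k \<in> V"
    using usco_sequence_cluster_point[OF compactin_values usc r(2), of "y \<circ> r"] y(1) by auto
  have "(\<beta> \<circ> r) \<longlonglongrightarrow> b"
    using \<beta> r(1) by (rule LIMSEQ_subseq_LIMSEQ)
  then have "z \<in> P b"
    using y(2) z by (intro closed_graph[of "\<beta> \<circ> r" b "y \<circ> r"]) auto
  then have "z \<in> slice \<tau> b"
    using z(1) r(3) by (auto simp: slice_def)
  moreover have "z \<in> F" if F: "closedin weak_topology F" "\<forall>\<^sub>F k in sequentially. y k \<in> F" for F
  proof (rule ccontr)
    assume "z \<notin> F"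
    then have "\<exists>\<^sub>F k in sequentially. (y \<circ> r) k \<in> UNIV - F"
      using F(1) by (intro z(2)) (auto simp: closedin_def)
    moreover have "\<forall>\<^sub>F k in sequentially. (y \<circ> r) k \<in> F"
      using eventually_subseq[OF r(1) F(2)] by simp
    ultimately show False
      by (simp add: frequently_def)
  qed
  ultimately show ?thesis by blast
qed

lemma slice_cluster_point:
  assumes \<beta>: "\<beta> \<longlonglongrightarrow> b" and y: "\<And>k. y k \<in> slice \<tau> (\<beta> k)"
  shows "\<exists>z\<in>slice \<tau> b. \<forall>F. closedin weak_topology F \<longrightarrow> (\<forall>\<^sub>F k in sequentially. y k \<in> F) \<longrightarrow> z \<in> F"
proof -
  have "\<forall>k. \<exists>\<sigma>. (\<forall>i. \<sigma> i \<le> \<tau> i) \<and> y k \<in> \<Psi> \<sigma>" using y by (auto simp: slice_def)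
  then obtain s where s: "\<And>k i. s k i \<le> \<tau> i" "\<And>k. y k \<in> \<Psi> (s k)" by metis
  have P: "y k \<in> P (\<beta> k)" for k using y by (auto simp: slice_def)
  have "s k i \<le> \<tau> i" if "i < k" for k i by (rule s(1))
  from slice_cluster_point_approx[OF \<beta> s(2) P this] show ?thesis .
qed

text \<open>This is upper semi-continuity of the slices in \<open>b\<close>; composed with a
  measurable \<open>F\<close> it yields measurable sets.\<close>

lemma closed_slice_meets:
  assumes F: "closedin weak_topology F"
  shows "closed {b. slice \<tau> b \<inter> F \<noteq> {}}"
  unfolding closed_sequential_limits
proof (intro allI impI, elim conjE)
  fix \<beta> b assume \<beta>: "\<forall>k. \<beta> k \<in> {b. slice \<tau> b \<inter> F \<noteq> {}}" "\<beta> \<longlonglongrightarrow> b"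
  then have "\<forall>k. \<exists>z. z \<in> slice \<tau> (\<beta> k) \<and> z \<in> F" by blast
  then obtain y where y: "\<And>k. y k \<in> slice \<tau> (\<beta> k)" "\<And>k. y k \<in> F"
    by metis
  obtain z where "z \<in> slice \<tau> b" "z \<in> F"
    using slice_cluster_point[OF \<beta>(2) y(1)] F always_eventually[of "\<lambda>k. y k \<in> F"] y(2) by blast
  then show "b \<in> {b. slice \<tau> b \<inter> F \<noteq> {}}" by auto
qed

text \<open>Cantor's intersection property: choose one point for each \<open>K j\<close> over the
  constant sequence \<open>b\<close>. A cluster point lies in every \<open>K j\<close>, since the
  choices eventually do.\<close>

lemma slice_Inter_nonempty:
  assumes K: "\<And>j::nat. closedin weak_topology (K j)" "\<And>j. K (Suc j) \<subseteq> K j"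
    and ne: "\<And>j. slice \<tau> b \<inter> K j \<noteq> {}"
  shows "slice \<tau> b \<inter> (\<Inter>j. K j) \<noteq> {}"
proof -
  have dec: "K j \<subseteq> K i" if "i \<le> j" for i j
    using K(2) that by (rule lift_Suc_antimono_le)
  have "\<forall>j. \<exists>z. z \<in> slice \<tau> b \<and> z \<in> K j" using ne by blast
  from choice[OF this] obtain y where "\<forall>j. y j \<in> slice \<tau> b \<and> y j \<in> K j" ..
  then have y: "y j \<in> slice \<tau> b" "y j \<in> K j" for j by auto
  obtain z where z: "z \<in> slice \<tau> b"
    "\<forall>F. closedin weak_topology F \<longrightarrow> (\<forall>\<^sub>F k in sequentially. y k \<in> F) \<longrightarrow> z \<in> F"
    using slice_cluster_point[where \<beta> = "\<lambda>_. b" and y = y, OF tendsto_const y(1)] ..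
  have "z \<in> K j" for j
  proof -
    have "y k \<in> K j" if "j \<le> k" for k using y(2)[of k] dec[OF that] by auto
    then have "\<forall>\<^sub>F k in sequentially. y k \<in> K j" by (rule eventually_sequentiallyI)
    then show ?thesis using z(2) K(1) by blast
  qed
  then show ?thesis using z(1) by blast
qed

text \<open>A capacitability argument: bounding the coordinates of the index one at a time keeps the
  outer measure strictly above \<open>c\<close>, which becomes \<open>\<le>\<close> in the limit.
  Measurability comes from writing the set as a decreasing intersection of preimages of closed
  sets.\<close>

lemma exists_large_measurable_slice:
  assumes M: "finite_measure M" and F: "F \<in> borel_measurable M"
    and c: "c < emeasure M (space M)"
  shows "\<exists>\<tau>. {x\<in>space M. slice \<tau> (F x) \<noteq> {}} \<in> sets M \<and>
    c \<le> emeasure M {x\<in>space M. slice \<tau> (F x) \<noteq> {}}"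
proof -
  interpret finite_measure M by fact
  \<comment> \<open>Only coordinates below \<open>k\<close> are bounded, so
    \<open>A 0 \<tau>\<close> is everything and \<open>A k \<tau>\<close> depends on finitely many
    values of \<open>\<tau>\<close>.\<close>
  define A where "A k \<tau> = {b. \<exists>\<sigma>. (\<forall>i<k. \<sigma> i \<le> \<tau> i) \<and> \<Psi> \<sigma> \<inter> P b \<noteq> {}}" for k and \<tau> :: "nat \<Rightarrow> nat"
  define E where "E k \<tau> = {x\<in>space M. F x \<in> A k \<tau>}" for k \<tau>
  have A_cong: "A k \<tau> = A k \<tau>'" if "\<And>i. i < k \<Longrightarrow> \<tau> i = \<tau>' i" for k \<tau> \<tau>'
    using that by (simp add: A_def)
  \<comment> \<open>The sets \<open>E k \<tau>\<close> need not be measurable, but the outer measure is continuous along increasing unions,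
    so one coordinate of \<open>\<tau>\<close> can be fixed at a time.\<close>
  have "\<exists>t. \<forall>k. c < outer_measure_of M (E k (t k)) \<and> (\<forall>i<k. t (Suc k) i = t k i)"
  proof (rule dependent_nat_choice)
    have "E 0 (\<lambda>_. 0) = space M" using meets by (auto simp: E_def A_def)
    then show "\<exists>x. c < outer_measure_of M (E 0 x)"
      using c by (intro exI[of _ "\<lambda>_. 0"]) simp
  next
    fix \<tau> k assume less: "c < outer_measure_of M (E k \<tau>)"
    have "E k \<tau> = (\<Union>j. E (Suc k) (\<tau>(k := j)))"
    proof safe
      fix x assume "x \<in> E k \<tau>"
      then obtain \<sigma> where "x \<in> space M" "\<forall>i<k. \<sigma> i \<le> \<tau> i" "\<Psi> \<sigma> \<inter> P (F x) \<noteq> {}"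
        by (auto simp: E_def A_def)
      then have "x \<in> E (Suc k) (\<tau>(k := \<sigma> k))"
        unfolding E_def A_def by (auto simp: less_Suc_eq)
      then show "x \<in> (\<Union>j. E (Suc k) (\<tau>(k := j)))" by blast
    next
      fix x j assume "x \<in> E (Suc k) (\<tau>(k := j))"
      then obtain \<sigma> where "x \<in> space M" "\<forall>i<Suc k. \<sigma> i \<le> (\<tau>(k := j)) i" "\<Psi> \<sigma> \<inter> P (F x) \<noteq> {}"
        by (auto simp: E_def A_def)
      moreover from this have "\<forall>i<k. \<sigma> i \<le> \<tau> i"
        by (metis fun_upd_other less_Suc_eq nat_neq_iff)
      ultimately show "x \<in> E k \<tau>" unfolding E_def A_def by blast
    qed
    moreover have "incseq (\<lambda>j. E (Suc k) (\<tau>(k := j)))"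
    proof (rule monoI, rule subsetI)
      fix i j :: nat and x assume "i \<le> j" "x \<in> E (Suc k) (\<tau>(k := i))"
      then obtain \<sigma> where "x \<in> space M" "\<forall>l<Suc k. \<sigma> l \<le> (\<tau>(k := i)) l" "\<Psi> \<sigma> \<inter> P (F x) \<noteq> {}"
        by (auto simp: E_def A_def)
      moreover from this \<open>i \<le> j\<close> have "\<forall>l<Suc k. \<sigma> l \<le> (\<tau>(k := j)) l"
        by (metis fun_upd_other fun_upd_same lessI order_trans)
      ultimately show "x \<in> E (Suc k) (\<tau>(k := j))" unfolding E_def A_def by blast
    qed
    moreover have "E (Suc k) (\<tau>(k := j)) \<subseteq> space M" for j by (auto simp: E_def)
    ultimately have "outer_measure_of M (E k \<tau>) = (SUP j. outer_measure_of M (E (Suc k) (\<tau>(k := j))))"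
      by (subst SUP_outer_measure_of_incseq) auto
    then obtain j where "c < outer_measure_of M (E (Suc k) (\<tau>(k := j)))"
      using less by (auto simp: less_SUP_iff)
    then show "\<exists>\<tau>'. c < outer_measure_of M (E (Suc k) \<tau>') \<and> (\<forall>i<k. \<tau>' i = \<tau> i)"
      by (intro exI[of _ "\<tau>(k := j)"]) auto
  qed
  then obtain t where t: "\<And>k. c < outer_measure_of M (E k (t k))" "\<And>k i. i < k \<Longrightarrow> t (Suc k) i = t k i"
    by blast
  \<comment> \<open>Stage \<open>i + 1\<close> fixes coordinate \<open>i\<close> for good, so the
    diagonal \<open>\<tau>\<close> agrees with \<open>t k\<close> below \<open>k\<close>.\<close>
  define \<tau> where "\<tau> i = t (Suc i) i" for i
  have t_eq: "t k i = \<tau> i" if "i < k" for k i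
    using that by (induction k) (auto simp: \<tau>_def less_Suc_eq t(2))
  have large: "c < outer_measure_of M (E k \<tau>)" for k
    using t(1)[of k] A_cong[of k "t k" \<tau>] t_eq by (simp add: E_def)
  have A_dec: "A (Suc k) \<tau> \<subseteq> A k \<tau>" for k
    unfolding A_def by (auto simp: less_Suc_eq)
  \<comment> \<open>A point of all the closures is the limit of some \<open>\<beta> k\<close> in
    \<open>A k \<tau>\<close>. The witnessing indices are bounded only in the coordinates below
    \<open>k\<close>, which is exactly what \<open>slice_cluster_point_approx\<close>
    accepts.\<close>
  have slice_iff: "slice \<tau> b \<noteq> {} \<longleftrightarrow> (\<forall>k. b \<in> closure (A k \<tau>))" for b
  proof
    assume "slice \<tau> b \<noteq> {}"
    then have "b \<in> A k \<tau>" for k by (auto simp: slice_def A_def)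
    then show "\<forall>k. b \<in> closure (A k \<tau>)" using closure_subset by blast
  next
    assume cl: "\<forall>k. b \<in> closure (A k \<tau>)"
    have "\<forall>k. \<exists>a. a \<in> A k \<tau> \<and> dist a b < inverse (real (Suc k))"
    proof
      fix k
      have "0 < inverse (real (Suc k))" by simp
      then show "\<exists>a. a \<in> A k \<tau> \<and> dist a b < inverse (real (Suc k))"
        using cl unfolding closure_approachable by blast
    qed
    from choice[OF this] obtain \<beta> where "\<forall>k. \<beta> k \<in> A k \<tau> \<and> dist (\<beta> k) b < inverse (real (Suc k))" ..
    then have \<beta>: "\<beta> k \<in> A k \<tau>" "dist (\<beta> k) b < inverse (real (Suc k))" for k by auto
    have "\<beta> \<longlonglongrightarrow> b"
    proof (rule iffD2[OF tendsto_dist_iff], rule Lim_null_comparison[OF _ LIMSEQ_inverse_real_of_nat])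
      have "norm (dist (\<beta> k) b) \<le> inverse (real (Suc k))" for k
        using less_imp_le[OF \<beta>(2)[of k]] by simp
      then show "\<forall>\<^sub>F k in sequentially. norm (dist (\<beta> k) b) \<le> inverse (real (Suc k))"
        by (intro always_eventually) blast
    qed
    moreover obtain s where s: "\<And>k i. i < k \<Longrightarrow> s k i \<le> \<tau> i" "\<And>k. \<Psi> (s k) \<inter> P (\<beta> k) \<noteq> {}"
      using \<beta>(1) unfolding A_def mem_Collect_eq by metis
    moreover have "\<forall>k. \<exists>z. z \<in> \<Psi> (s k) \<and> z \<in> P (\<beta> k)" using s(2) by blast
    then obtain y where "\<And>k. y k \<in> \<Psi> (s k)" "\<And>k. y k \<in> P (\<beta> k)"
      by metis
    ultimately show "slice \<tau> b \<noteq> {}"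
      using slice_cluster_point_approx[of \<beta> b y s \<tau>] by blast
  qed
  define G where "G k = {x\<in>space M. F x \<in> closure (A k \<tau>)}" for k
  have G: "G k \<in> sets M" for k
  proof -
    have "F -` closure (A k \<tau>) \<inter> space M \<in> sets M"
      using F by (rule measurable_sets) (simp add: borel_closed)
    moreover have "F -` closure (A k \<tau>) \<inter> space M = G k" by (auto simp: G_def)
    ultimately show ?thesis by simp
  qed
  have eq: "{x\<in>space M. slice \<tau> (F x) \<noteq> {}} = (\<Inter>k. G k)"
    by (auto simp: slice_iff G_def)
  have "decseq G"
    unfolding decseq_Suc_iff G_def using closure_mono[OF A_dec] by blast
  then have "emeasure M (\<Inter>k. G k) = (INF k. emeasure M (G k))"
    using G by (intro INF_emeasure_decseq[symmetric]) auto
  moreover have "c \<le> emeasure M (G k)" for k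
  proof -
    have "E k \<tau> \<subseteq> G k" unfolding E_def G_def using closure_subset by blast
    then have "outer_measure_of M (E k \<tau>) \<le> emeasure M (G k)"
      using outer_measure_of_mono outer_measure_of_eq[OF G] by metis
    then show ?thesis using large[of k] by simp
  qed
  ultimately have "c \<le> emeasure M (\<Inter>k. G k)" by (auto intro: INF_greatest)
  moreover have "(\<Inter>k. G k) \<in> sets M" using G by auto
  ultimately show ?thesis unfolding eq[symmetric] by blast
qed

end

subsection \<open>Measurable selections\<close>

text \<open>Separability passes to subsets of metric spaces: \<open>h\<close> picks a point of
  \<open>A\<close> near \<open>c\<close> for each pair of a point \<open>c\<close> and a radius
  \<open>1 / (n + 1)\<close> that admits one.\<close>

lemma countable_dense_subset:
  fixes A C :: "'b::metric_space set"
  assumes C: "countable C" and A: "A \<subseteq> closure C"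
  shows "\<exists>D. countable D \<and> D \<subseteq> A \<and> A \<subseteq> closure D"
proof -
  define I where "I = {(c, n). c \<in> C \<and> (\<exists>a\<in>A. dist a c < inverse (real (Suc n)))}"
  define h where "h = (\<lambda>(c, n). SOME a. a \<in> A \<and> dist a c < inverse (real (Suc n)))"
  have h: "h (c, n) \<in> A" "dist (h (c, n)) c < inverse (real (Suc n))" if "(c, n) \<in> I" for c n
  proof -
    have "\<exists>a. a \<in> A \<and> dist a c < inverse (real (Suc n))" using that by (auto simp: I_def)
    from someI_ex[OF this] show "h (c, n) \<in> A" "dist (h (c, n)) c < inverse (real (Suc n))"
      by (auto simp: h_def)
  qed
  have "countable (C \<times> (UNIV :: nat set))" using C by simp
  then have "countable I" by (rule countable_subset[rotated]) (auto simp: I_def)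
  then have "countable (h ` I)" by simp
  moreover have "h ` I \<subseteq> A" using h by auto
  moreover have "a \<in> closure (h ` I)" if a: "a \<in> A" for a
    unfolding closure_approachable
  proof (intro allI impI)
    fix e :: real assume "0 < e"
    then obtain n where n: "inverse (real (Suc n)) < e / 2"
      using reals_Archimedean[of "e / 2"] by auto
    have "0 < inverse (real (Suc n))" by simp
    moreover have "a \<in> closure C" using a A by blast
    ultimately obtain c where c: "c \<in> C" "dist c a < inverse (real (Suc n))"
      unfolding closure_approachable by blast
    then have I: "(c, n) \<in> I" using a by (auto simp: I_def dist_commute)
    have "dist (h (c, n)) a \<le> dist (h (c, n)) c + dist c a" by (rule dist_triangle)
    also have "\<dots> < e" using h(2)[OF I] c(2) n by simp
    finally show "\<exists>y\<in>h ` I. dist y a < e" using I by blast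
  qed
  ultimately show ?thesis by (intro exI[of _ "h ` I"]) auto
qed

text \<open>\<open>Q\<close> consists of the finite linear combinations of \<open>D\<close> with
  rational coefficients, encoded by lists; real scalars are reached in the limit.\<close>

lemma countable_dense_in_closed_subspace:
  fixes D :: "'a::real_normed_vector set"
  assumes D: "countable D"
  shows "\<exists>Q. countable Q \<and> D \<subseteq> Q \<and> subspace (closure Q)"
proof -
  define comb :: "(real \<times> 'a) list \<Rightarrow> 'a" where "comb l = sum_list (map (\<lambda>(c, a). c *\<^sub>R a) l)" for l
  define Q where "Q = comb ` lists (\<rat> \<times> D)"
  have "countable (lists ((\<rat> :: real set) \<times> D))"
    using D countable_rat by (intro countable_lists countable_SIGMA) auto
  then have "countable Q" by (simp add: Q_def)
  moreover have "D \<subseteq> Q"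
  proof
    fix a assume "a \<in> D"
    then have "[(1, a)] \<in> lists (\<rat> \<times> D)" by simp
    moreover have "comb [(1, a)] = a" by (simp add: comb_def)
    ultimately show "a \<in> Q" unfolding Q_def by (metis imageI)
  qed
  moreover have add: "x + y \<in> Q" if x: "x \<in> Q" and y: "y \<in> Q" for x y
  proof -
    obtain k where "k \<in> lists (\<rat> \<times> D)" "x = comb k"
      using x unfolding Q_def by blast
    moreover obtain l where "l \<in> lists (\<rat> \<times> D)" "y = comb l"
      using y unfolding Q_def by blast
    ultimately show ?thesis unfolding Q_def
      by (intro image_eqI[of _ _ "k @ l"]) (auto simp: comb_def)
  qed
  have scale: "c *\<^sub>R x \<in> Q" if c: "c \<in> \<rat>" and x: "x \<in> Q" for c x
  proof -
    obtain l where l: "l \<in> lists (\<rat> \<times> D)" "x = comb l"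
      using x unfolding Q_def by blast
    have "c *\<^sub>R comb l = comb (map (\<lambda>(d, a). (c * d, a)) l)" for l
      by (induction l) (auto simp: comb_def scaleR_add_right)
    moreover have "map (\<lambda>(d, a). (c * d, a)) l \<in> lists (\<rat> \<times> D)"
      using l(1) c by (auto simp: in_lists_conv_set)
    ultimately show ?thesis unfolding Q_def l(2) by (metis imageI)
  qed
  have "subspace (closure Q)"
  proof (rule subspaceI)
    have "comb [] \<in> Q" unfolding Q_def by (rule imageI) simp
    then show "0 \<in> closure Q" using closure_subset[of Q] by (auto simp: comb_def)
  next
    fix x y assume "x \<in> closure Q" "y \<in> closure Q"
    then obtain s t where "\<forall>n. s n \<in> Q" "s \<longlonglongrightarrow> x" "\<forall>n. t n \<in> Q" "t \<longlonglongrightarrow> y"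
      unfolding closure_sequential by blast
    then have "\<forall>n. s n + t n \<in> Q" "(\<lambda>n. s n + t n) \<longlonglongrightarrow> x + y"
      using add by (auto intro: tendsto_add)
    then show "x + y \<in> closure Q"
      unfolding closure_sequential by (intro exI[of _ "\<lambda>n. s n + t n"]) auto
  next
    fix c :: real and x assume x: "x \<in> closure Q"
    have "c \<in> closure \<rat>"
by (simp add: Rats_closure_real)
    with x obtain s t where "\<forall>n. s n \<in> Q" "s \<longlonglongrightarrow> x" "\<forall>n. t n \<in> \<rat>" "t \<longlonglongrightarrow> c"
      unfolding closure_sequential by blast
    then have "\<forall>n. t n *\<^sub>R s n \<in> Q" "(\<lambda>n. t n *\<^sub>R s n) \<longlonglongrightarrow> c *\<^sub>R x"
      using scale by (auto intro: tendsto_scaleR)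
    then show "c *\<^sub>R x \<in> closure Q"
      unfolding closure_sequential by (intro exI[of _ "\<lambda>n. t n *\<^sub>R s n"]) auto
  qed
  ultimately show ?thesis by blast
qed

section \<open>Selection by successive minimisation of distances\<close>

context weak_usco_multifunction
begin

text \<open>Stage \<open>k + 1\<close> keeps the points nearest to \<open>d k\<close>: within the
  slice and stage \<open>k\<close>, lying in the ball means attaining the minimum. Using balls, and
  leaving the slice outside the recursion, keeps every stage weakly closed when \<open>Y\<close>
  is.\<close>

primrec lex_refine :: "(nat \<Rightarrow> nat) \<Rightarrow> 'a set \<Rightarrow> (nat \<Rightarrow> 'a) \<Rightarrow> 'b \<Rightarrow> nat \<Rightarrow> 'a set" where
  "lex_refine \<tau> Y d b 0 = Y"
| "lex_refine \<tau> Y d b (Suc k) = lex_refine \<tau> Y d b k \<inter>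
     cball (d k) (INF y\<in>slice \<tau> b \<inter> lex_refine \<tau> Y d b k. dist (d k) y)"

lemma closedin_lex_refine:
  assumes "closedin weak_topology Y"
  shows "closedin weak_topology (lex_refine \<tau> Y d b k)"
  using assms by (induction k) (auto intro!: closedin_Int closedin_weak_cball)

text \<open>Compactness of the slice gives a common point of the balls of radius
  \<open>m + 1 / (j + 1)\<close>; this is why infima of distances are attained.\<close>

lemma slice_meets_cball:
  assumes K: "closedin weak_topology K" and ne: "\<And>e. 0 < e \<Longrightarrow> slice \<tau> b \<inter> (K \<inter> cball c (m + e)) \<noteq> {}"
  shows "slice \<tau> b \<inter> (K \<inter> cball c m) \<noteq> {}"
proof -
  have "slice \<tau> b \<inter> (\<Inter>j. K \<inter> cball c (m + inverse (real (Suc j)))) \<noteq> {}"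
  proof (rule slice_Inter_nonempty)
    show "closedin weak_topology (K \<inter> cball c (m + inverse (real (Suc j))))" for j
      by (intro closedin_Int closedin_weak_cball K)
    show "K \<inter> cball c (m + inverse (real (Suc (Suc j)))) \<subseteq> K \<inter> cball c (m + inverse (real (Suc j)))" for j
    proof -
      have "inverse (real (Suc (Suc j))) \<le> inverse (real (Suc j))" by (simp add: field_simps)
      then have "m + inverse (real (Suc (Suc j))) \<le> m + inverse (real (Suc j))" by simp
      from subset_cball[OF this] show ?thesis by blast
    qed
    show "slice \<tau> b \<inter> (K \<inter> cball c (m + inverse (real (Suc j)))) \<noteq> {}" for j
      by (rule ne) simp
  qed
  then obtain y where "y \<in> slice \<tau> b" "y \<in> (\<Inter>j. K \<inter> cball c (m + inverse (real (Suc j))))"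
    by blast
  then have y: "y \<in> slice \<tau> b" "y \<in> K" "dist c y \<le> m + inverse (real (Suc j))" for j
    by auto
  have "dist c y \<le> m"
  proof (rule field_le_epsilon)
    fix e :: real assume "0 < e"
    then obtain j where "inverse (real (Suc j)) < e" using reals_Archimedean by blast
    then show "dist c y \<le> m + e" using y(3)[of j] by simp
  qed
  then show ?thesis using y by auto
qed

lemma lex_refine_dist:
  assumes "y \<in> slice \<tau> b" "y \<in> lex_refine \<tau> Y d b k"
  shows "(INF y\<in>slice \<tau> b \<inter> lex_refine \<tau> Y d b k. dist (d k) y) \<le> dist (d k) y"
  using assms by (intro cINF_lower bdd_belowI2[of _ 0]) auto

lemma slice_lex_refine_nonempty:
  assumes Y: "closedin weak_topology Y" and ne: "slice \<tau> b \<inter> Y \<noteq> {}"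
  shows "slice \<tau> b \<inter> lex_refine \<tau> Y d b k \<noteq> {}"
proof (induction k)
  case 0
  then show ?case using ne by simp
next
  case (Suc k)
  define m where "m = (INF y\<in>slice \<tau> b \<inter> lex_refine \<tau> Y d b k. dist (d k) y)"
  have "slice \<tau> b \<inter> (lex_refine \<tau> Y d b k \<inter> cball (d k) m) \<noteq> {}"
  proof (rule slice_meets_cball)
    show "closedin weak_topology (lex_refine \<tau> Y d b k)" by (rule closedin_lex_refine[OF Y])
    fix e :: real assume "0 < e"
    then have "m < m + e" by simp
    then obtain y where "y \<in> slice \<tau> b \<inter> lex_refine \<tau> Y d b k" "dist (d k) y < m + e"
      unfolding m_def using cINF_less_iff[OF Suc, of "dist (d k)"]
      by (metis bdd_belowI2 zero_le_dist)
    then show "slice \<tau> b \<inter> (lex_refine \<tau> Y d b k \<inter> cball (d k) (m + e)) \<noteq> {}" by auto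
  qed
  then show ?case by (simp add: m_def)
qed

text \<open>The infimum, which varies with \<open>b\<close>, is replaced by rational radii, so that
  countable operations suffice for measurability. Forwards, a minimiser in \<open>G\<close> lies in
  every ball that meets the stage; backwards, radii slightly above the minimum \<open>m\<close> and
  \<open>slice_meets_cball\<close> give a minimiser in \<open>G\<close>.\<close>

lemma slice_lex_refine_Suc_iff:
  assumes Y: "closedin weak_topology Y" and ne: "slice \<tau> b \<inter> Y \<noteq> {}" and G: "closedin weak_topology G"
  shows "slice \<tau> b \<inter> (lex_refine \<tau> Y d b (Suc k) \<inter> G) \<noteq> {} \<longleftrightarrow>
    (\<forall>q::rat. slice \<tau> b \<inter> (lex_refine \<tau> Y d b k \<inter> cball (d k) (of_rat q)) \<noteq> {} \<longrightarrow>
       slice \<tau> b \<inter> (lex_refine \<tau> Y d b k \<inter> (G \<inter> cball (d k) (of_rat q))) \<noteq> {})"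
    (is "?L \<longleftrightarrow> ?R")
proof -
  define m where "m = (INF y\<in>slice \<tau> b \<inter> lex_refine \<tau> Y d b k. dist (d k) y)"
  have m_le: "m \<le> dist (d k) y" if "y \<in> slice \<tau> b" "y \<in> lex_refine \<tau> Y d b k" for y
    unfolding m_def using that by (rule lex_refine_dist)
  have Suc: "lex_refine \<tau> Y d b (Suc k) = lex_refine \<tau> Y d b k \<inter> cball (d k) m"
    by (simp add: m_def)
  show ?thesis
  proof
    assume ?L
    then obtain y where y: "y \<in> slice \<tau> b" "y \<in> lex_refine \<tau> Y d b k" "dist (d k) y \<le> m" "y \<in> G"
      unfolding Suc by auto
    show ?R
    proof (intro allI impI)
      fix q :: rat assume "slice \<tau> b \<inter> (lex_refine \<tau> Y d b k \<inter> cball (d k) (of_rat q)) \<noteq> {}"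
      then obtain z where "z \<in> slice \<tau> b" "z \<in> lex_refine \<tau> Y d b k" "dist (d k) z \<le> of_rat q" by auto
      then have "m \<le> of_rat q" using m_le by (meson order_trans)
      then show "slice \<tau> b \<inter> (lex_refine \<tau> Y d b k \<inter> (G \<inter> cball (d k) (of_rat q))) \<noteq> {}"
        using y by (auto intro!: exI[of _ y])
    qed
  next
    assume R: ?R
    have "slice \<tau> b \<inter> ((lex_refine \<tau> Y d b k \<inter> G) \<inter> cball (d k) m) \<noteq> {}"
    proof (rule slice_meets_cball)
      show "closedin weak_topology (lex_refine \<tau> Y d b k \<inter> G)"
        by (intro closedin_Int closedin_lex_refine Y G)
      fix e :: real assume "0 < e"
      then obtain q where q: "m < of_rat q" "of_rat q < m + e" using of_rat_dense[of m "m + e"] by auto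
      obtain z where "z \<in> slice \<tau> b" "z \<in> lex_refine \<tau> Y d b (Suc k)"
        using slice_lex_refine_nonempty[OF Y ne, of d "Suc k"] by blast
      then have "slice \<tau> b \<inter> (lex_refine \<tau> Y d b k \<inter> cball (d k) (of_rat q)) \<noteq> {}"
        unfolding Suc using q(1) by (auto intro!: exI[of _ z])
      then have "slice \<tau> b \<inter> (lex_refine \<tau> Y d b k \<inter> (G \<inter> cball (d k) (of_rat q))) \<noteq> {}"
        using R by blast
      then show "slice \<tau> b \<inter> ((lex_refine \<tau> Y d b k \<inter> G) \<inter> cball (d k) (m + e)) \<noteq> {}"
        using q(2) by fastforce
    qed
    then show ?L unfolding Suc by auto
  qed
qed

text \<open>Induction over the stages, with \<open>G\<close> arbitrary because the step intersects
  it with balls. The base case is \<open>closed_slice_meets\<close>; the step is a countable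
  intersection over the rational radii.\<close>

lemma sets_slice_lex_refine:
  assumes F: "F \<in> borel_measurable M" and E: "E \<in> sets M" and Y: "closedin weak_topology Y"
    and ne: "\<And>x. x \<in> E \<Longrightarrow> slice \<tau> (F x) \<inter> Y \<noteq> {}"
  shows "closedin weak_topology G \<Longrightarrow>
    {x\<in>E. slice \<tau> (F x) \<inter> (lex_refine \<tau> Y d (F x) k \<inter> G) \<noteq> {}} \<in> sets M"
proof (induction k arbitrary: G)
  case 0
  have "F -` {b. slice \<tau> b \<inter> (Y \<inter> G) \<noteq> {}} \<inter> space M \<in> sets M"
    using F by (rule measurable_sets) (intro borel_closed closed_slice_meets closedin_Int Y 0)
  then have "E \<inter> (F -` {b. slice \<tau> b \<inter> (Y \<inter> G) \<noteq> {}} \<inter> space M) \<in> sets M"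
    using E by (rule sets.Int[rotated])
  moreover have "E \<inter> (F -` {b. slice \<tau> b \<inter> (Y \<inter> G) \<noteq> {}} \<inter> space M) =
      {x\<in>E. slice \<tau> (F x) \<inter> (lex_refine \<tau> Y d (F x) 0 \<inter> G) \<noteq> {}}"
    using sets.sets_into_space[OF E] by auto
  ultimately show ?case by simp
next
  case (Suc k)
  define A where "A q = {x\<in>E. slice \<tau> (F x) \<inter> (lex_refine \<tau> Y d (F x) k \<inter> cball (d k) (of_rat q)) \<noteq> {}}" for q :: rat
  define B where "B q = {x\<in>E. slice \<tau> (F x) \<inter> (lex_refine \<tau> Y d (F x) k \<inter> (G \<inter> cball (d k) (of_rat q))) \<noteq> {}}" for q :: rat
  have A: "A q \<in> sets M" and B: "B q \<in> sets M" for q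
    unfolding A_def B_def by (intro Suc.IH closedin_Int closedin_weak_cball Suc.prems)+
  have "(\<Inter>q. (E - A q) \<union> B q) \<in> sets M"
    using A B E by (intro sets.countable_INT) auto
  then have "E \<inter> (\<Inter>q. (E - A q) \<union> B q) \<in> sets M"
    using E by blast
  moreover have "E \<inter> (\<Inter>q. (E - A q) \<union> B q) =
      {x\<in>E. slice \<tau> (F x) \<inter> (lex_refine \<tau> Y d (F x) (Suc k) \<inter> G) \<noteq> {}}"
  proof -
    have "slice \<tau> (F x) \<inter> (lex_refine \<tau> Y d (F x) (Suc k) \<inter> G) \<noteq> {} \<longleftrightarrow> (\<forall>q. x \<in> A q \<longrightarrow> x \<in> B q)"
      if "x \<in> E" for x
      unfolding slice_lex_refine_Suc_iff[OF Y ne[OF that] Suc.prems] A_def B_def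
      using that by simp
    then show ?thesis by blast
  qed
  ultimately show ?case by simp
qed

text \<open>A separable reduction is followed by the minimisation. Only preimages of balls are
  recorded: measurable distances are enough for strong measurability once the values lie in a
  separable set.\<close>

lemma measurable_selection_on_slice:
  assumes F: "F \<in> borel_measurable M" and C: "countable C" "\<And>x. x \<in> space M \<Longrightarrow> F x \<in> closure C"
    and E: "E \<in> sets M" "\<And>x. x \<in> E \<Longrightarrow> slice \<tau> (F x) \<noteq> {}"
  shows "\<exists>g Q. countable Q \<and> (\<forall>x\<in>E. g x \<in> P (F x) \<and> g x \<in> closure Q) \<and>
    (\<forall>z r. {x\<in>E. g x \<in> cball z r} \<in> sets M)"
proof -
  have "F ` E \<subseteq> closure C" using C(2) sets.sets_into_space[OF E(1)] by blast
  from countable_dense_subset[OF C(1) this]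
  obtain D where D: "countable D" "D \<subseteq> F ` E" "F ` E \<subseteq> closure D" by blast
  have "\<forall>b\<in>D. \<exists>y. y \<in> slice \<tau> b" using D(2) E(2) by blast
  from bchoice[OF this] obtain y where y: "\<forall>b\<in>D. y b \<in> slice \<tau> b" ..
  have "countable (y ` D)" using D(1) by simp
  from countable_dense_in_closed_subspace[OF this]
  obtain Q where Q: "countable Q" "y ` D \<subseteq> Q" "subspace (closure Q)" by blast
  define Y where "Y = closure Q"
  have Y: "closedin weak_topology Y"
    unfolding Y_def by (intro closedin_weak_closed_subspace Q(3) closed_closure)
  \<comment> \<open>Values were chosen only over the dense set \<open>D\<close>; closedness of the
    condition carries it to \<open>closure D\<close>, hence to the whole image of \<open>E\<close>
    under \<open>F\<close>.\<close>
  have "D \<subseteq> {b. slice \<tau> b \<inter> Y \<noteq> {}}"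
    using y Q(2) closure_subset[of Q] unfolding Y_def by blast
  then have "closure D \<subseteq> {b. slice \<tau> b \<inter> Y \<noteq> {}}"
    by (rule closure_minimal) (rule closed_slice_meets[OF Y])
  then have ne: "slice \<tau> (F x) \<inter> Y \<noteq> {}" if "x \<in> E" for x
    using D(3) that by blast
  have "Q \<noteq> {}" using Q(3) subspace_0 by fastforce
  then obtain d :: "nat \<Rightarrow> 'a" where d: "range d = Q"
    using Q(1) uncountable_def by blast
  define S where "S x = slice \<tau> (F x) \<inter> (\<Inter>k. lex_refine \<tau> Y d (F x) k)" for x
  \<comment> \<open>Points surviving all stages have the same distance to every \<open>d k\<close>,
    and the \<open>d k\<close> are dense in \<open>Y\<close>, which contains these points.\<close>
  have unique: "u = v" if "u \<in> S x" "v \<in> S x" for u v x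
  proof -
    have eq: "dist (d k) w = (INF y\<in>slice \<tau> (F x) \<inter> lex_refine \<tau> Y d (F x) k. dist (d k) y)"
      if "w \<in> S x" for w k
    proof (rule antisym)
      have "w \<in> lex_refine \<tau> Y d (F x) (Suc k)" using that unfolding S_def by blast
      then show "dist (d k) w \<le> (INF y\<in>slice \<tau> (F x) \<inter> lex_refine \<tau> Y d (F x) k. dist (d k) y)"
        by simp
      show "(INF y\<in>slice \<tau> (F x) \<inter> lex_refine \<tau> Y d (F x) k. dist (d k) y) \<le> dist (d k) w"
        using that unfolding S_def by (intro lex_refine_dist) auto
    qed
    have "u \<in> lex_refine \<tau> Y d (F x) 0" using that(1) unfolding S_def by blast
    then have u: "u \<in> closure (range d)" by (simp add: Y_def d)
    have "dist u v \<le> 0 + e" if "0 < e" for e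
    proof -
      obtain k where "dist (d k) u < e / 2"
        using u \<open>0 < e\<close> unfolding closure_approachable by (metis half_gt_zero rangeE)
      moreover have "dist (d k) v = dist (d k) u" using eq \<open>u \<in> S x\<close> \<open>v \<in> S x\<close> by simp
      ultimately show ?thesis using dist_triangle3[of u v "d k"] by simp
    qed
    then have "dist u v \<le> 0" by (rule field_le_epsilon)
    then show ?thesis by simp
  qed
  have dec: "lex_refine \<tau> Y d b (Suc k) \<subseteq> lex_refine \<tau> Y d b k" for b k by auto
  have S_meets: "S x \<inter> G \<noteq> {} \<longleftrightarrow> (\<forall>k. slice \<tau> (F x) \<inter> (lex_refine \<tau> Y d (F x) k \<inter> G) \<noteq> {})"
    if G: "closedin weak_topology G" for x G
  proof
    assume "S x \<inter> G \<noteq> {}"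
    then show "\<forall>k. slice \<tau> (F x) \<inter> (lex_refine \<tau> Y d (F x) k \<inter> G) \<noteq> {}"
      unfolding S_def by blast
  next
    assume "\<forall>k. slice \<tau> (F x) \<inter> (lex_refine \<tau> Y d (F x) k \<inter> G) \<noteq> {}"
    then have "slice \<tau> (F x) \<inter> (\<Inter>k. lex_refine \<tau> Y d (F x) k \<inter> G) \<noteq> {}"
      using dec by (intro slice_Inter_nonempty closedin_Int closedin_lex_refine Y G) blast+
    then show "S x \<inter> G \<noteq> {}" unfolding S_def by blast
  qed
  have "S x \<noteq> {}" if "x \<in> E" for x
    using S_meets[OF closedin_topspace, of x] slice_lex_refine_nonempty[OF Y ne[OF that]] by simp
  then have "\<forall>x\<in>E. \<exists>u. u \<in> S x" by blast
  from bchoice[OF this] obtain g where "\<forall>x\<in>E. g x \<in> S x" ..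
  then have g: "g x \<in> S x" if "x \<in> E" for x using that by blast
  have "g x \<in> P (F x) \<and> g x \<in> closure Q" if "x \<in> E" for x
  proof -
    have "g x \<in> lex_refine \<tau> Y d (F x) 0" using g[OF that] unfolding S_def by blast
    moreover have "g x \<in> slice \<tau> (F x)" using g[OF that] unfolding S_def by blast
    ultimately show ?thesis by (simp add: Y_def slice_def)
  qed
  moreover have "{x\<in>E. g x \<in> cball z r} \<in> sets M" for z r
  proof -
    \<comment> \<open>Since \<open>S x\<close> is the singleton of \<open>g x\<close>, a ball
      contains \<open>g x\<close> exactly when it meets \<open>S x\<close>, and this can be tested
      stage by stage.\<close>
    have "g x \<in> cball z r \<longleftrightarrow> S x \<inter> cball z r \<noteq> {}" if "x \<in> E" for x
      using g[OF that] unique[of _ x "g x"] by blast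
    then have "g x \<in> cball z r \<longleftrightarrow>
        (\<forall>k. slice \<tau> (F x) \<inter> (lex_refine \<tau> Y d (F x) k \<inter> cball z r) \<noteq> {})" if "x \<in> E" for x
      unfolding S_meets[OF closedin_weak_cball] using that by blast
    then have "{x\<in>E. g x \<in> cball z r} =
        (\<Inter>k. {x\<in>E. slice \<tau> (F x) \<inter> (lex_refine \<tau> Y d (F x) k \<inter> cball z r) \<noteq> {}})"
      by blast
    also have "\<dots> \<in> sets M"
      using sets_slice_lex_refine[OF F E(1) Y ne closedin_weak_cball]
      by (intro sets.countable_INT) auto
    finally show ?thesis .
  qed
  ultimately show ?thesis using Q(1) by blast
qed

end

text \<open>The approximants take the nearest of \<open>d 0\<close>, ..., \<open>d N\<close>, with
  ties broken by the least index; they have finitely many values and converge wherever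
  \<open>g x\<close> is in the closure of the range.\<close>

lemma strongly_measurable_if_dist_measurable:
  fixes g :: "'s \<Rightarrow> 'a::real_normed_vector" and d :: "nat \<Rightarrow> 'a"
  assumes meas: "\<And>j. (\<lambda>x. dist (g x) (d j)) \<in> borel_measurable M"
    and cl: "AE x in M. g x \<in> closure (range d)"
  shows "strongly_measurable M g"
proof -
  define best where "best N x j \<longleftrightarrow> j \<le> N \<and> (\<forall>i\<le>N. dist (g x) (d j) \<le> dist (g x) (d i))" for N x and j :: nat
  define idx where "idx N x = (LEAST j. best N x j)" for N x
  have best: "best N x (idx N x)" for N x
  proof -
    have "\<exists>j\<in>{..N}. is_arg_min (\<lambda>j. dist (g x) (d j)) (\<lambda>j. j \<in> {..N}) j"
      using ex_is_arg_min_if_finite[of "{..N}" "\<lambda>j. dist (g x) (d j)"]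
      by (auto simp: is_arg_min_def)
    then obtain j where "best N x j"
      by (auto simp: best_def is_arg_min_linorder)
    then show ?thesis unfolding idx_def by (rule LeastI)
  qed
  have "simple_function M (\<lambda>x. d (idx N x))" for N
  proof -
    have [measurable]: "Measurable.pred M (\<lambda>x. best N x j)" for j
      unfolding best_def using meas by measurable
    have "idx N \<in> measurable M (count_space UNIV)"
      unfolding idx_def[abs_def] by measurable
    moreover have "idx N ` space M \<subseteq> {..N}" using best by (auto simp: best_def)
    ultimately have "simple_function M (idx N)"
      by (auto simp: simple_function_def intro: finite_subset)
    from simple_function_compose[OF this, of d] show ?thesis by (simp add: comp_def)
  qed
  moreover have "(\<lambda>N. d (idx N x)) \<longlonglongrightarrow> g x" if "g x \<in> closure (range d)" for x
  proof (rule metric_LIMSEQ_I)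
    fix e :: real assume "0 < e"
    then obtain j where j: "dist (d j) (g x) < e"
      using \<open>g x \<in> closure (range d)\<close> unfolding closure_approachable by blast
    have "dist (d (idx N x)) (g x) < e" if "j \<le> N" for N
    proof -
      have "dist (g x) (d (idx N x)) \<le> dist (g x) (d j)"
        using best[of N x] that unfolding best_def by blast
      then show ?thesis using j by (simp add: dist_commute)
    qed
    then show "\<exists>N0. \<forall>N\<ge>N0. dist (d (idx N x)) (g x) < e" by blast
  qed
  then have "AE x in M. (\<lambda>N. d (idx N x)) \<longlonglongrightarrow> g x"
    using cl by (auto elim: eventually_mono)
  ultimately show ?thesis
    unfolding strongly_measurable_def by (intro exI[of _ "\<lambda>N x. d (idx N x)"]) auto
qed

section \<open>Gluing selections over sets of almost full measure\<close>

context weak_usco_multifunction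
begin

text \<open>The sets \<open>E m\<close> have measure at least \<open>1 - 1 / (m + 1)\<close>, so
  their union has full measure; each point uses the selection belonging to the first
  \<open>E m\<close> that contains it.\<close>

theorem strongly_measurable_selection:
  fixes F :: "'s \<Rightarrow> 'b"
  assumes M: "prob_space M" and S: "\<And>j::nat. simple_function M (S j)"
    and lim: "\<And>x. x \<in> space M \<Longrightarrow> (\<lambda>j. S j x) \<longlonglongrightarrow> F x"
  shows "\<exists>g. strongly_measurable M g \<and> (AE x in M. g x \<in> P (F x))"
proof -
  interpret prob_space M by fact
  have F: "F \<in> borel_measurable M"
    using borel_measurable_simple_function[OF S] lim by (rule borel_measurable_LIMSEQ_metric)
  define C where "C = (\<Union>j. S j ` space M)"
  have "countable (S j ` space M)" for j
    using S by (intro countable_finite) (simp add: simple_function_def)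
  then have C: "countable C" unfolding C_def by simp
  have FC: "F x \<in> closure C" if x: "x \<in> space M" for x
  proof -
    have "\<forall>j. S j x \<in> C" using x by (auto simp: C_def)
    then show ?thesis unfolding closure_sequential using lim[OF x] by (intro exI[of _ "\<lambda>j. S j x"]) simp
  qed
  define c where "c m = ennreal (1 - inverse (real (Suc m)))" for m
  have "\<exists>\<tau>. {x\<in>space M. slice \<tau> (F x) \<noteq> {}} \<in> sets M \<and> c m \<le> emeasure M {x\<in>space M. slice \<tau> (F x) \<noteq> {}}" for m
  proof -
    have "c m < emeasure M (space M)"
      unfolding c_def emeasure_space_1 by (simp add: ennreal_less_one_iff)
    from exists_large_measurable_slice[OF finite_measure_axioms F this] show ?thesis .
  qed
  then have "\<forall>m. \<exists>\<tau>. {x\<in>space M. slice \<tau> (F x) \<noteq> {}} \<in> sets M \<and> c m \<le> emeasure M {x\<in>space M. slice \<tau> (F x) \<noteq> {}}"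
    by blast
  from choice[OF this] obtain \<tau> where \<tau>: "\<forall>m. {x\<in>space M. slice (\<tau> m) (F x) \<noteq> {}} \<in> sets M \<and>
      c m \<le> emeasure M {x\<in>space M. slice (\<tau> m) (F x) \<noteq> {}}" ..
  define E where "E m = {x\<in>space M. slice (\<tau> m) (F x) \<noteq> {}}" for m
  have E: "E m \<in> sets M" "c m \<le> emeasure M (E m)" for m using \<tau> by (auto simp: E_def)
  have "\<forall>m. \<exists>gQ. countable (snd gQ) \<and> (\<forall>x\<in>E m. fst gQ x \<in> P (F x) \<and> fst gQ x \<in> closure (snd gQ)) \<and>
    (\<forall>z r. {x\<in>E m. fst gQ x \<in> cball z r} \<in> sets M)"
  proof
    fix m
    have "slice (\<tau> m) (F x) \<noteq> {}" if "x \<in> E m" for x using that by (simp add: E_def)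
    from measurable_selection_on_slice[OF F C FC E(1) this]
    show "\<exists>gQ. countable (snd gQ) \<and> (\<forall>x\<in>E m. fst gQ x \<in> P (F x) \<and> fst gQ x \<in> closure (snd gQ)) \<and>
        (\<forall>z r. {x\<in>E m. fst gQ x \<in> cball z r} \<in> sets M)"
      by simp
  qed
  from choice[OF this] obtain gQ where gQ: "\<forall>m. countable (snd (gQ m)) \<and>
    (\<forall>x\<in>E m. fst (gQ m) x \<in> P (F x) \<and> fst (gQ m) x \<in> closure (snd (gQ m))) \<and>
    (\<forall>z r. {x\<in>E m. fst (gQ m) x \<in> cball z r} \<in> sets M)" ..
  define h where "h m = fst (gQ m)" for m
  \<comment> \<open>Inserting \<open>0\<close> makes \<open>Q\<close> nonempty, so that
    \<open>from_nat_into\<close> enumerates it.\<close>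
  define Q where "Q = insert 0 (\<Union>m. snd (gQ m))"
  have h: "h m x \<in> P (F x)" "h m x \<in> closure (snd (gQ m))" if "x \<in> E m" for m x
    using gQ that by (auto simp: h_def)
  have h_meas: "{x\<in>E m. h m x \<in> cball z r} \<in> sets M" for m z r
    using gQ by (simp add: h_def)
  have "countable Q" unfolding Q_def using gQ by auto
  moreover have "Q \<noteq> {}" by (simp add: Q_def)
  moreover define d where "d = from_nat_into Q"
  ultimately have d: "range d = Q" by (simp add: range_from_nat_into)
  define idx where "idx x = (LEAST m. x \<in> E m)" for x
  define g where "g x = (if \<exists>m. x \<in> E m then h (idx x) x else 0)" for x
  have idx: "x \<in> E (idx x)" if "x \<in> E m" for x m
    unfolding idx_def using that by (rule LeastI)
  have gP: "g x \<in> P (F x)" "g x \<in> closure Q" if "x \<in> E m" for x m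
  proof -
    have "closure (snd (gQ (idx x))) \<subseteq> closure Q" by (intro closure_mono) (auto simp: Q_def)
    moreover have "g x = h (idx x) x" using that by (auto simp: g_def)
    ultimately show "g x \<in> P (F x)" "g x \<in> closure Q" using h[OF idx[OF that]] by auto
  qed
  have "emeasure M (\<Union>m. E m) \<ge> 1"
  proof (rule tendsto_upperbound[of c 1])
    have "(\<lambda>m. 1 - inverse (real (Suc m))) \<longlonglongrightarrow> 1 - 0"
      by (intro tendsto_intros LIMSEQ_inverse_real_of_nat)
    then have "(\<lambda>m. ennreal (1 - inverse (real (Suc m)))) \<longlonglongrightarrow> ennreal (1 - 0)"
      by (rule tendsto_ennrealI)
    then show "c \<longlonglongrightarrow> 1" by (simp add: c_def[abs_def])
    have "emeasure M (E m) \<le> emeasure M (\<Union>m. E m)" for m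
      using E(1) by (intro emeasure_mono) auto
    then show "\<forall>\<^sub>F m in sequentially. c m \<le> emeasure M (\<Union>m. E m)"
      using E(2) by (intro always_eventually allI) (rule order_trans)
  qed auto
  then have "emeasure M (\<Union>m. E m) = 1"
    using emeasure_space[of M "\<Union>m. E m"] emeasure_space_1 by simp
  then have "prob (\<Union>m. E m) = 1" by (simp add: measure_def)
  then have AE: "AE x in M. x \<in> (\<Union>m. E m)"
    using E(1) by (intro AE_prob_1)
  have meas: "(\<lambda>x. dist (g x) z) \<in> borel_measurable M" for z
    unfolding borel_measurable_iff_le
  proof
    fix r
    \<comment> \<open>This is the part of the sublevel set on which \<open>m\<close> is the first
      index; \<open>B\<close> below accounts for the points outside all \<open>E m\<close>, where
      \<open>g\<close> has the default value \<open>0\<close>.\<close>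
    define A where "A m = {x\<in>E m. h m x \<in> cball z r} - (\<Union>l<m. E l)" for m
    have "A m \<in> sets M" for m
      unfolding A_def using E(1) h_meas by (intro sets.Diff sets.finite_UN) auto
    then have A: "(\<Union>m. A m) \<in> sets M" by blast
    define B where "B = (if dist 0 z \<le> r then space M - (\<Union>m. E m) else {})"
    have B: "B \<in> sets M" unfolding B_def using E(1) by auto
    have A_iff: "x \<in> (\<Union>m. A m) \<longleftrightarrow> dist (g x) z \<le> r" if x: "x \<in> E m" for x m
    proof -
      have "x \<in> A k \<longleftrightarrow> k = idx x \<and> dist (h k x) z \<le> r" for k
      proof
        assume k: "x \<in> A k"
        then have "x \<in> E k" "\<And>l. l < k \<Longrightarrow> x \<notin> E l" by (auto simp: A_def)
        then have "idx x = k" unfolding idx_def by (intro Least_equality) (auto simp: not_le[symmetric])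
        then show "k = idx x \<and> dist (h k x) z \<le> r" using k by (auto simp: A_def dist_commute)
      next
        assume k: "k = idx x \<and> dist (h k x) z \<le> r"
        then have "x \<notin> E l" if "l < k" for l
          using that not_less_Least[of l "\<lambda>m. x \<in> E m"] by (simp add: idx_def)
        then show "x \<in> A k" using k idx[OF x] by (auto simp: A_def dist_commute)
      qed
      moreover have "g x = h (idx x) x" using x by (auto simp: g_def)
      ultimately show ?thesis by simp
    qed
    have "x \<in> {x\<in>space M. dist (g x) z \<le> r} \<longleftrightarrow> x \<in> (\<Union>m. A m) \<union> B" for x
    proof (cases "\<exists>m. x \<in> E m")
      case True
      then obtain m where m: "x \<in> E m" ..
      then have "x \<in> space M" "x \<notin> B" by (auto simp: E_def B_def)
      then show ?thesis using A_iff[OF m] by blast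
    next
      case False
      then have "x \<notin> (\<Union>m. A m)" "g x = 0" by (auto simp: A_def g_def)
      then show ?thesis using False by (simp add: B_def)
    qed
    then have "{x\<in>space M. dist (g x) z \<le> r} = (\<Union>m. A m) \<union> B" by (rule set_eqI)
    then show "{x\<in>space M. dist (g x) z \<le> r} \<in> sets M" using A B by auto
  qed
  have "strongly_measurable M g"
    using AE gP(2) by (intro strongly_measurable_if_dist_measurable[where d = d] meas)
      (auto simp: d elim!: eventually_mono)
  moreover have "AE x in M. g x \<in> P (F x)"
    using AE gP(1) by (auto elim!: eventually_mono)
  ultimately show ?thesis by blast
qed

end

subsection \<open>Relative centers and Bochner spaces\<close>

text \<open>The sum of powers converges along the tuples for fixed \<open>v\<close> and is weakly
  lower semi-continuous in the candidate center, because balls are weakly closed. Hence optimality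
  of \<open>y k\<close> against each \<open>v\<close> passes to the cluster point
  \<open>z\<close>.\<close>

lemma relative_center_closed_graph:
  fixes \<beta> :: "nat \<Rightarrow> nat \<Rightarrow> 'a::real_normed_vector"
  assumes p: "0 < p" and \<beta>: "\<beta> \<longlonglongrightarrow> b" and y: "\<And>k. relative_center p n (\<beta> k) Y (y k)"
    and z: "z \<in> Y"
    and cluster: "\<And>V. openin weak_topology V \<Longrightarrow> z \<in> V \<Longrightarrow> \<exists>\<^sub>F k in sequentially. y k \<in> V"
  shows "relative_center p n b Y z"
  unfolding relative_center_def
proof (intro conjI z ballI)
  fix v assume v: "v \<in> Y"
  have \<beta>i: "(\<lambda>k. \<beta> k i) \<longlonglongrightarrow> b i" for i
    using \<beta> unfolding tendsto_fun_iff by blast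
  define R where "R = (\<Sum>i<n. norm (b i - v) powr p)"
  have lim: "(\<lambda>k. \<Sum>i<n. norm (\<beta> k i - v) powr p) \<longlonglongrightarrow> R"
    unfolding R_def using p by (intro tendsto_sum tendsto_powr' tendsto_norm tendsto_diff \<beta>i tendsto_const) auto
  \<comment> \<open>One \<open>\<delta>\<close> is lost to weak lower semi-continuity, the other to
    replacing \<open>\<beta> k i\<close> by \<open>b i\<close>. The \<open>max 0\<close> keeps the
    base nonnegative for the monotonicity of \<open>powr\<close>.\<close>
  have approx: "(\<Sum>i<n. max 0 (norm (b i - z) - 2 * \<delta>) powr p) \<le> R" (is "?L \<le> R") if \<delta>: "0 < \<delta>" for \<delta>
  proof (rule ccontr)
    assume "\<not> ?L \<le> R"
    then have "\<forall>\<^sub>F k in sequentially. (\<Sum>i<n. norm (\<beta> k i - v) powr p) < ?L"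
      using lim by (intro order_tendstoD(2)[of _ R]) auto
    moreover have "\<forall>\<^sub>F k in sequentially. \<forall>i\<in>{..<n}. dist (\<beta> k i) (b i) < \<delta>"
      using tendstoD[OF \<beta>i \<delta>] by (intro eventually_ball_finite) auto
    ultimately have ev: "\<forall>\<^sub>F k in sequentially.
        (\<Sum>i<n. norm (\<beta> k i - v) powr p) < ?L \<and> (\<forall>i\<in>{..<n}. dist (\<beta> k i) (b i) < \<delta>)"
      by (rule eventually_conj)
    \<comment> \<open>Norms are weakly lower semi-continuous: \<open>V\<close> is a weak neighbourhood of \<open>z\<close>.\<close>
    define V where "V = UNIV - (\<Union>i\<in>{..<n}. cball (b i) (norm (b i - z) - \<delta>))"
    have "closedin weak_topology (\<Union>i\<in>{..<n}. cball (b i) (norm (b i - z) - \<delta>))"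
      by (intro closedin_Union) (auto intro: closedin_weak_cball)
    then have "openin weak_topology V" by (simp add: V_def closedin_def)
    moreover have "z \<in> V" using \<delta> by (auto simp: V_def dist_norm)
    ultimately have "\<exists>\<^sub>F k in sequentially. y k \<in> V" by (rule cluster)
    from frequently_ex[OF frequently_eventually_conj[OF this ev]]
    obtain k where k: "y k \<in> V" "(\<Sum>i<n. norm (\<beta> k i - v) powr p) < ?L"
      "\<And>i. i < n \<Longrightarrow> dist (\<beta> k i) (b i) < \<delta>"
      by auto
    have "?L \<le> (\<Sum>i<n. norm (\<beta> k i - y k) powr p)"
    proof (intro sum_mono powr_mono2)
      fix i assume "i \<in> {..<n}"
      then have "norm (b i - z) - \<delta> < dist (b i) (y k)" "dist (\<beta> k i) (b i) < \<delta>"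
        using k(1,3) by (auto simp: V_def not_le)
      then have "norm (b i - z) - 2 * \<delta> \<le> norm (\<beta> k i - y k)"
        using dist_triangle2[of "b i" "y k" "\<beta> k i"] dist_triangle[of "b i" "y k" "\<beta> k i"]
        by (simp add: dist_norm norm_minus_commute)
      then show "max 0 (norm (b i - z) - 2 * \<delta>) \<le> norm (\<beta> k i - y k)" by simp
    qed (use p in auto)
    also have "\<dots> \<le> (\<Sum>i<n. norm (\<beta> k i - v) powr p)"
      using y[of k] v by (simp add: relative_center_def)
    finally show False using k(2) by simp
  qed
  have "(\<lambda>j. \<Sum>i<n. max 0 (norm (b i - z) - 2 * inverse (real (Suc j))) powr p)
      \<longlonglongrightarrow> (\<Sum>i<n. max 0 (norm (b i - z) - 2 * 0) powr p)"
    using p by (intro tendsto_sum tendsto_powr' tendsto_max tendsto_diff tendsto_mult tendsto_const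
        LIMSEQ_inverse_real_of_nat) auto
  then have "(\<Sum>i<n. max 0 (norm (b i - z) - 2 * 0) powr p) \<le> R"
    by (rule LIMSEQ_le_const2) (auto intro!: approx)
  then show "(\<Sum>i<n. norm (b i - z) powr p) \<le> (\<Sum>i<n. norm (b i - v) powr p)"
    by (simp add: R_def)
qed

section \<open>Bochner measurability and integrability\<close>

lemma (in complete_measure) borel_measurable_cong_AE_complete:
  assumes h: "h \<in> measurable M N" and eq: "AE x in M. h x = f x" and f: "f \<in> space M \<rightarrow> space N"
  shows "f \<in> measurable M N"
proof (rule measurableI)
  show "f x \<in> space N" if "x \<in> space M" for x using f that by auto
  fix A assume A: "A \<in> sets N"
  show "f -` A \<inter> space M \<in> sets M"
  proof (rule in_sets_AE)
    show "h -` A \<inter> space M \<in> sets M" using h A by (rule measurable_sets)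
    show "AE x in M. x \<in> h -` A \<inter> space M \<longleftrightarrow> x \<in> f -` A \<inter> space M"
      using eq by eventually_elim auto
  qed auto
qed

text \<open>Setting the simple functions and \<open>f\<close> to \<open>0\<close> on the exceptional
  null set gives convergence everywhere; completeness then transfers measurability back to
  \<open>f\<close>.\<close>

lemma (in complete_measure) strongly_measurable_imp_borel_measurable:
  fixes f :: "'a \<Rightarrow> 'b::real_normed_vector"
  assumes "strongly_measurable M f"
  shows "f \<in> borel_measurable M"
proof -
  obtain s where s: "\<forall>i::nat. simple_function M (s i)" "AE x in M. (\<lambda>i. s i x) \<longlonglongrightarrow> f x"
    using assms unfolding strongly_measurable_def by blast
  define N where "N = {x\<in>space M. \<not> (\<lambda>i. s i x) \<longlonglongrightarrow> f x}"
  have N: "N \<in> null_sets M" using s(2) unfolding N_def AE_iff_null_sets .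
  define h where "h x = (if x \<in> N then 0 else f x)" for x
  have "h \<in> borel_measurable M"
  proof (rule borel_measurable_LIMSEQ_metric)
    show "(\<lambda>x. if x \<in> N then 0 else s i x) \<in> borel_measurable M" for i
      using s(1) null_setsD2[OF N]
      by (intro borel_measurable_simple_function simple_function_If_set) auto
    show "(\<lambda>i. if x \<in> N then 0 else s i x) \<longlonglongrightarrow> h x" if "x \<in> space M" for x
      using that by (auto simp: h_def N_def)
  qed
  moreover have "AE x in M. h x = f x"
    using AE_not_in[OF N] by eventually_elim (simp add: h_def)
  ultimately show ?thesis by (rule borel_measurable_cong_AE_complete) simp
qed

lemma strongly_measurable_diff:
  assumes "strongly_measurable M f" "strongly_measurable M g"
  shows "strongly_measurable M (\<lambda>x. f x - g x)"
proof -
  obtain s t where s: "\<forall>i::nat. simple_function M (s i)" "AE x in M. (\<lambda>i. s i x) \<longlonglongrightarrow> f x"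
    and t: "\<forall>i::nat. simple_function M (t i)" "AE x in M. (\<lambda>i. t i x) \<longlonglongrightarrow> g x"
    using assms unfolding strongly_measurable_def by blast
  have "\<forall>i. simple_function M (\<lambda>x. s i x - t i x)"
    using s(1) t(1) by (auto intro: simple_function_compose2[where h = "(-)"])
  moreover have "AE x in M. (\<lambda>i. s i x - t i x) \<longlonglongrightarrow> f x - g x"
    using s(2) t(2) by eventually_elim (rule tendsto_diff)
  ultimately show ?thesis
    unfolding strongly_measurable_def by (intro exI[of _ "\<lambda>i x. s i x - t i x"]) auto
qed

text \<open>The norm of the difference is at most twice the larger norm, whence the constant
  \<open>2 powr p\<close>.\<close>

lemma norm_diff_powr_le:
  fixes a b :: "'a::real_normed_vector"
  assumes "0 \<le> p"
  shows "norm (a - b) powr p \<le> 2 powr p * (norm a powr p + norm b powr p)"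
proof -
  have "norm (a - b) \<le> 2 * max (norm a) (norm b)"
    using norm_triangle_ineq4[of a b] by simp
  then have "norm (a - b) powr p \<le> (2 * max (norm a) (norm b)) powr p"
    using assms by (intro powr_mono2) auto
  also have "\<dots> = 2 powr p * max (norm a) (norm b) powr p"
    by (simp add: powr_mult)
  also have "\<dots> \<le> 2 powr p * (norm a powr p + norm b powr p)"
    by (intro mult_left_mono) (auto simp: max_def)
  finally show ?thesis .
qed

lemma (in complete_measure) integrable_norm_powr_dominated:
  fixes f :: "'a \<Rightarrow> 'b::real_normed_vector" and w :: "'a \<Rightarrow> real"
  assumes f: "strongly_measurable M f" and w: "integrable M w"
    and le: "AE x in M. norm (f x) powr p \<le> w x"
  shows "integrable M (\<lambda>x. norm (f x) powr p)"
proof (rule Bochner_Integration.integrable_bound[OF w])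
  have [measurable]: "f \<in> borel_measurable M"
    using f by (rule strongly_measurable_imp_borel_measurable)
  show "(\<lambda>x. norm (f x) powr p) \<in> borel_measurable M" by measurable
  show "AE x in M. norm (norm (f x) powr p) \<le> norm (w x)"
    using le by eventually_elim simp
qed

lemma (in complete_measure) Lp_space_diff_integrable:
  assumes p: "0 \<le> p" and f: "f \<in> Lp_space M p A" and g: "g \<in> Lp_space M p B"
  shows "integrable M (\<lambda>x. norm (f x - g x) powr p)"
proof (rule integrable_norm_powr_dominated)
  show "strongly_measurable M (\<lambda>x. f x - g x)"
    using f g by (intro strongly_measurable_diff) (auto simp: Lp_space_def)
  show "integrable M (\<lambda>x. 2 powr p * (norm (f x) powr p + norm (g x) powr p))"
    using f g by (auto simp: Lp_space_def)
qed (use p in \<open>auto intro: norm_diff_powr_le\<close>)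

lemma Lp_norm_powr:
  assumes "0 < p"
  shows "Lp_norm M p f powr p = (\<integral>x. norm (f x) powr p \<partial>M)"
  unfolding Lp_norm_def using assms by (simp add: powr_powr powr_one integral_nonneg_AE)

text \<open>Tuples become points of the metric space of sequences by padding with \<open>0\<close>
  from \<open>n\<close> on; each induction step overwrites one more coordinate.\<close>

lemma simple_function_tuple:
  fixes g :: "nat \<Rightarrow> 's \<Rightarrow> 'a::zero"
  assumes "\<And>i. i < n \<Longrightarrow> simple_function M (g i)"
  shows "simple_function M (\<lambda>x i. if i < n then g i x else 0)"
  using assms
proof (induction n)
  case 0
  then show ?case by simp
next
  case (Suc n)
  have "simple_function M (\<lambda>x. (\<lambda>i. if i < n then g i x else 0)(n := g n x))"
    using Suc by (intro simple_function_compose2[where h = "\<lambda>v a. v(n := a)"]) auto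
  moreover have "(\<lambda>x. (\<lambda>i. if i < n then g i x else 0)(n := g n x)) = (\<lambda>x i. if i < Suc n then g i x else 0)"
    by (auto simp: fun_eq_iff less_Suc_eq)
  ultimately show ?case by simp
qed

text \<open>The selection theorem is applied to the centers as a multifunction of the tuple;
  proximinality provides the centers that \<open>meets\<close> asks for.\<close>

theorem strongly_measurable_relative_center:
  fixes f :: "nat \<Rightarrow> 's \<Rightarrow> 'a::real_normed_vector"
  assumes M: "prob_space M" "complete_measure M" and p: "0 < p"
    and Y: "weakly_K_analytic Y" "simult_proximinal p n Y"
    and f: "\<And>i. i < n \<Longrightarrow> strongly_measurable M (f i)"
  shows "\<exists>g. strongly_measurable M g \<and> (AE x in M. relative_center p n (\<lambda>i. f i x) Y (g x))"
proof -
  interpret complete_measure M by fact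
  from Y(1)[unfolded weakly_K_analytic_def K_analytic_in_def] obtain \<Psi> :: "(nat \<Rightarrow> nat) \<Rightarrow> 'a set" where
    "(\<forall>\<sigma>. \<Psi> \<sigma> \<noteq> {} \<and> compactin weak_topology (\<Psi> \<sigma>)) \<and>
     (\<forall>\<sigma> V. openin weak_topology V \<and> \<Psi> \<sigma> \<subseteq> V \<longrightarrow>
       (\<exists>U. open U \<and> \<sigma> \<in> U \<and> (\<Union>u\<in>U. \<Psi> u) \<subseteq> V)) \<and> Y = (\<Union>\<sigma>. \<Psi> \<sigma>)" ..
  then have \<Psi>: "\<forall>\<sigma>. \<Psi> \<sigma> \<noteq> {} \<and> compactin weak_topology (\<Psi> \<sigma>)"
    "\<forall>\<sigma> V. openin weak_topology V \<and> \<Psi> \<sigma> \<subseteq> V \<longrightarrow>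
       (\<exists>U. open U \<and> \<sigma> \<in> U \<and> (\<Union>u\<in>U. \<Psi> u) \<subseteq> V)"
    "Y = (\<Union>\<sigma>. \<Psi> \<sigma>)"
    by simp_all
  have "weak_usco_multifunction \<Psi> (\<lambda>b. {y. relative_center p n b Y y})"
  proof
    show "compactin weak_topology (\<Psi> \<sigma>)" for \<sigma> using \<Psi>(1) by blast
    show "\<exists>U. open U \<and> \<sigma> \<in> U \<and> (\<Union>u\<in>U. \<Psi> u) \<subseteq> V"
      if "openin weak_topology V" "\<Psi> \<sigma> \<subseteq> V" for \<sigma> V using \<Psi>(2) that by blast
    show "\<exists>\<sigma>. \<Psi> \<sigma> \<inter> {y. relative_center p n b Y y} \<noteq> {}" for b
    proof -
      obtain y where y: "relative_center p n b Y y"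
        using Y(2) unfolding simult_proximinal_def by blast
      then have "y \<in> Y" by (simp add: relative_center_def)
      then show ?thesis using y \<Psi>(3) by blast
    qed
    show "z \<in> {y. relative_center p n b Y y}"
      if "\<beta> \<longlonglongrightarrow> b" "\<And>k. y k \<in> {y. relative_center p n (\<beta> k) Y y}" "z \<in> \<Psi> \<sigma>"
        "\<And>V. openin weak_topology V \<Longrightarrow> z \<in> V \<Longrightarrow> \<exists>\<^sub>F k in sequentially. y k \<in> V"
      for \<beta> b y z \<sigma>
    proof -
      have "z \<in> Y" using that(3) \<Psi>(3) by blast
      then show ?thesis
        using relative_center_closed_graph[OF p that(1) _ _ that(4), of n Y] that(2) by simp
    qed
  qed
  then interpret weak_usco_multifunction \<Psi> "\<lambda>b. {y. relative_center p n b Y y}" .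
  have "\<forall>i. \<exists>s. i < n \<longrightarrow> (\<forall>j::nat. simple_function M (s j)) \<and> (AE x in M. (\<lambda>j. s j x) \<longlonglongrightarrow> f i x)"
    using f unfolding strongly_measurable_def by blast
  from choice[OF this] obtain s where
    "\<forall>i. i < n \<longrightarrow> (\<forall>j::nat. simple_function M (s i j)) \<and> (AE x in M. (\<lambda>j. s i j x) \<longlonglongrightarrow> f i x)" ..
  then have s: "simple_function M (s i j)" "AE x in M. (\<lambda>j. s i j x) \<longlonglongrightarrow> f i x"
    if "i < n" for i j using that by auto
  have AE: "AE x in M. \<forall>i. i < n \<longrightarrow> (\<lambda>j. s i j x) \<longlonglongrightarrow> f i x"
    unfolding AE_all_countable using s(2) by auto
  define N where "N = {x\<in>space M. \<not> (\<forall>i. i < n \<longrightarrow> (\<lambda>j. s i j x) \<longlonglongrightarrow> f i x)}"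
  have N: "N \<in> null_sets M" using AE unfolding N_def AE_iff_null_sets .
  \<comment> \<open>The value \<open>0\<close> on the null set \<open>N\<close> and from
    \<open>n\<close> on gives the everywhere convergence that the selection theorem demands; centers
    depend only on the first \<open>n\<close> entries.\<close>
  define S where "S j x = (\<lambda>i. if i < n then (if x \<in> N then 0 else s i j x) else 0)" for j x
  define F where "F x = (\<lambda>i. if i < n then (if x \<in> N then 0 else f i x) else 0)" for x
  have S: "simple_function M (S j)" for j
    unfolding S_def using s(1) null_setsD2[OF N]
    by (intro simple_function_tuple simple_function_If_set) auto
  have lim: "(\<lambda>j. S j x) \<longlonglongrightarrow> F x" if "x \<in> space M" for x
    unfolding tendsto_fun_iff
  proof
    fix i
    show "(\<lambda>j. S j x i) \<longlonglongrightarrow> F x i"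
    proof (cases "i < n \<and> x \<notin> N")
      case True
      then have "(\<lambda>j. s i j x) \<longlonglongrightarrow> f i x" using that unfolding N_def by blast
      then show ?thesis using True by (simp add: S_def F_def)
    next
      case False
      then show ?thesis by (auto simp: S_def F_def)
    qed
  qed
  obtain g where g: "strongly_measurable M g" "AE x in M. g x \<in> {y. relative_center p n (F x) Y y}"
    using strongly_measurable_selection[OF M(1) S lim] by blast
  have "AE x in M. relative_center p n (\<lambda>i. f i x) Y (g x)"
    using g(2) AE_not_in[OF N] by eventually_elim (simp add: relative_center_def F_def)
  then show ?thesis using g(1) by blast
qed

theorem mainTheorem1:
  fixes M :: "'s measure" and Y :: "'a::banach set" and p :: real and n :: nat
  assumes "prob_space M" and "complete_measure M"
    and "1 \<le> p" and "0 < n"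
    and "subspace Y"
    and "weakly_K_analytic Y"
    and "simult_proximinal p n Y"
  shows "\<forall>f :: nat \<Rightarrow> 's \<Rightarrow> 'a. (\<forall>i<n. f i \<in> Lp_space M p UNIV) \<longrightarrow>
           (\<exists>g\<in>Lp_space M p Y. \<forall>h\<in>Lp_space M p Y.
              (\<Sum>i<n. Lp_norm M p (\<lambda>x. f i x - g x) powr p)
                \<le> (\<Sum>i<n. Lp_norm M p (\<lambda>x. f i x - h x) powr p))"
proof (intro allI impI)
  fix f :: "nat \<Rightarrow> 's \<Rightarrow> 'a" assume f: "\<forall>i<n. f i \<in> Lp_space M p UNIV"
  interpret complete_measure M by fact
  have p: "0 < p" "0 \<le> p" using assms(3) by auto
  have f_meas: "strongly_measurable M (f i)" if "i < n" for i
    using f that by (auto simp: Lp_space_def)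
  have f_int: "integrable M (\<lambda>x. norm (f i x) powr p)" if "i < n" for i
    using f that by (auto simp: Lp_space_def)
  have "\<exists>g. strongly_measurable M g \<and> (AE x in M. relative_center p n (\<lambda>i. f i x) Y (g x))"
    using assms p f_meas by (intro strongly_measurable_relative_center) auto
  then obtain g where g: "strongly_measurable M g" "AE x in M. relative_center p n (\<lambda>i. f i x) Y (g x)"
    by blast
  have "integrable M (\<lambda>x. norm (g x) powr p)"
  proof (rule integrable_norm_powr_dominated[OF g(1)])
    \<comment> \<open>Comparing the center with \<open>0\<close> in \<open>Y\<close> bounds the
      distance from \<open>f 0 x\<close> to \<open>g x\<close>; \<open>f 0\<close> is one of the
      given functions because \<open>0 < n\<close>.\<close>
    show "integrable M (\<lambda>x. 2 powr p * (norm (f 0 x) powr p + (\<Sum>i<n. norm (f i x) powr p)))"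
      using f_int assms(4)
      by (intro integrable_mult_right Bochner_Integration.integrable_add Bochner_Integration.integrable_sum) auto
    show "AE x in M. norm (g x) powr p \<le> 2 powr p * (norm (f 0 x) powr p + (\<Sum>i<n. norm (f i x) powr p))"
      using g(2)
    proof eventually_elim
      case (elim x)
      have "norm (f 0 x - g x) powr p \<le> (\<Sum>i<n. norm (f i x - g x) powr p)"
        using assms(4) by (intro member_le_sum[of 0 _ "\<lambda>i. norm (f i x - g x) powr p"]) auto
      also have "\<dots> \<le> (\<Sum>i<n. norm (f i x - 0) powr p)"
        using elim subspace_0[OF assms(5)] unfolding relative_center_def by blast
      finally have "norm (f 0 x - g x) powr p \<le> (\<Sum>i<n. norm (f i x) powr p)" by simp
      moreover have "norm (g x) powr p \<le> 2 powr p * (norm (f 0 x) powr p + norm (f 0 x - g x) powr p)"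
        using norm_diff_powr_le[OF p(2), of "f 0 x" "f 0 x - g x"] by simp
      ultimately show ?case
        by (elim order_trans) (intro mult_left_mono, auto)
    qed
  qed
  moreover have "AE x in M. g x \<in> Y"
    using g(2) by eventually_elim (simp add: relative_center_def)
  ultimately have gLp: "g \<in> Lp_space M p Y" using g(1) by (simp add: Lp_space_def)
  \<comment> \<open>The exponent of the centers equals that of the space, so the objective is the
    integral of the pointwise one.\<close>
  have sum_eq: "(\<Sum>i<n. Lp_norm M p (\<lambda>x. f i x - h x) powr p) = (\<integral>x. (\<Sum>i<n. norm (f i x - h x) powr p) \<partial>M)"
    and sum_int: "integrable M (\<lambda>x. \<Sum>i<n. norm (f i x - h x) powr p)"
    if "h \<in> Lp_space M p Y" for h
  proof -
    have int: "integrable M (\<lambda>x. norm (f i x - h x) powr p)" if "i \<in> {..<n}" for i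
      using f that by (intro Lp_space_diff_integrable[OF p(2) _ \<open>h \<in> Lp_space M p Y\<close>, where A = UNIV]) simp
    show "integrable M (\<lambda>x. \<Sum>i<n. norm (f i x - h x) powr p)"
      by (rule Bochner_Integration.integrable_sum) (rule int)
    show "(\<Sum>i<n. Lp_norm M p (\<lambda>x. f i x - h x) powr p) = (\<integral>x. (\<Sum>i<n. norm (f i x - h x) powr p) \<partial>M)"
      unfolding Lp_norm_powr[OF p(1)]
      by (rule Bochner_Integration.integral_sum[symmetric]) (rule int)
  qed
  show "\<exists>g\<in>Lp_space M p Y. \<forall>h\<in>Lp_space M p Y. (\<Sum>i<n. Lp_norm M p (\<lambda>x. f i x - g x) powr p)
      \<le> (\<Sum>i<n. Lp_norm M p (\<lambda>x. f i x - h x) powr p)"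
  proof (intro bexI[OF _ gLp] ballI)
    fix h assume h: "h \<in> Lp_space M p Y"
    \<comment> \<open>Almost every value \<open>h x\<close> lies in \<open>Y\<close> and therefore
      competes with the center \<open>g x\<close>.\<close>
    have "AE x in M. (\<Sum>i<n. norm (f i x - g x) powr p) \<le> (\<Sum>i<n. norm (f i x - h x) powr p)"
    proof -
      have "AE x in M. h x \<in> Y" using h by (simp add: Lp_space_def)
      with g(2) show ?thesis by eventually_elim (auto simp: relative_center_def)
    qed
    then show "(\<Sum>i<n. Lp_norm M p (\<lambda>x. f i x - g x) powr p) \<le> (\<Sum>i<n. Lp_norm M p (\<lambda>x. f i x - h x) powr p)"
      unfolding sum_eq[OF gLp] sum_eq[OF h] by (intro integral_mono_AE sum_int gLp h)
  qed
qed

end
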